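(* Let $J$ be a complex $n\times n$ matrix in Jordan canonical form with $p$ distinct eigenvalues $\lambda_1,\dots,\lambda_p$, where $\lambda_a$ occurs in exactly $N_a$ Jordan blocks, of orders $k_{a1}\ge k_{a2}\ge\cdots\ge k_{aN_a}\geq 1$. Put $k_{aj}=0$ for $j>N_a$, let $N^\ast=\max_a N_a$, and let $m_j=\sum_{a=1}^p k_{aj}$ (the degree of the $j$-th invariant polynomial of $J$). Then the complex dimension of the set of complex $n\times n$ matrices with Jordan form $J$, i.e. of $\{A : A=TJT^{-1} \text{ for some invertible } T\in C^{nn}\}$, is $$n^2-\sum_{j=1}^{N^\ast}(2j-1)\sum_{a=1}^p k_{aj}\;=\;n^2-\sum_{j=1}^{N^\ast}(2j-1)\,m_j .$$
   Context: $C^{nn}$ is the space of complex $n\times n$ matrices. A Jordan block of order $k$ with eigenvalue $\lambda$ is $\lambda I+H$ with $I$ the $k\times k$ identity and $H$ the $k\times k$ matrix with ones on the first superdiagonal and zeros elsewhere. Invariant polynomials are ordered with the one of highest degree (the minimal polynomial) first, each subsequent one dividing the previous one. "Complex dimension" of a subset of $C^{nn}$ is the usual dimension over $\mathbb C$ (of a complex manifold, or of a constructible subset of affine space). *)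

theory Defs
  imports
    "HOL-Analysis.Analysis"
    "HOL-Computational_Algebra.Field_as_Ring"
    "HOL-Computational_Algebra.Polynomial_Factorial"
    "Jordan_Normal_Form.Jordan_Normal_Form"
    "Jordan_Normal_Form.DL_Submatrix"
begin

text \<open>
  Holomorphic maps of several variables, meant for open \<open>U\<close>: real (Frechet) differentiable at every
  point, with complex linear derivative.
\<close>

definition holomorphic_map_on ::
  "(complex ^ 'm \<Rightarrow> complex ^ 'k) \<Rightarrow> (complex ^ 'm) set \<Rightarrow> bool" where
  "holomorphic_map_on f U \<longleftrightarrow>
     (\<forall>x\<in>U. \<exists>D. (f has_derivative D) (at x) \<and> Vector_Spaces.linear (*s) (*s) D)"

text \<open>
  \<open>S\<close> is an embedded complex submanifold, all of whose components have complex dimension \<open>d\<close>: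
  near each of its points some biholomorphic map \<open>\<phi>\<close> straightens \<open>S\<close> to a \<open>d\<close>-dimensional complex
  linear subspace. Here \<^const>\<open>vec.subspace\<close> and \<^const>\<open>vec.dim\<close> are taken over the complex numbers.
\<close>

definition complex_submanifold :: "(complex ^ 'm) set \<Rightarrow> nat \<Rightarrow> bool" where
  "complex_submanifold S d \<longleftrightarrow>
     (\<forall>x\<in>S. \<exists>U (V :: (complex ^ 'm) set) \<phi> \<psi> L.
        open U \<and> x \<in> U \<and> open V \<and> homeomorphism U V \<phi> \<psi> \<and>
        holomorphic_map_on \<phi> U \<and> holomorphic_map_on \<psi> V \<and>
        vec.subspace L \<and> vec.dim L = d \<and> \<phi> ` (S \<inter> U) = V \<inter> L)"

definition complex_dim :: "(complex ^ 'm) set \<Rightarrow> nat" where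
  "complex_dim S = (THE d. complex_submanifold S d)"

lemma complex_submanifold_dim_le:
  fixes S V1 V2 :: "(complex ^ 'm) set"
  assumes U: "open U1" "x \<in> U1" "open U2" "x \<in> U2" and V: "open V1" "open V2"
    and hom: "homeomorphism U1 V1 f1 g1" "homeomorphism U2 V2 f2 g2"
    and hol: "holomorphic_map_on f1 U1" "holomorphic_map_on g1 V1"
      "holomorphic_map_on f2 U2" "holomorphic_map_on g2 V2"
    and L: "vec.subspace L1" "vec.subspace L2"
    and im: "f1 ` (S \<inter> U1) = V1 \<inter> L1" "f2 ` (S \<inter> U2) = V2 \<inter> L2"
    and x: "x \<in> S"
  shows "vec.dim L1 \<le> vec.dim L2"
proof -
  define z where "z = f1 x"
  define w where "w = f2 x"
  have zV: "z \<in> V1" and wV: "w \<in> V2" and g1z: "g1 z = x" and g2w: "g2 w = x"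
    using U hom by (auto simp: z_def w_def homeomorphism_def)
  have zL: "z \<in> L1" using im(1) x U by (auto simp: z_def)
  obtain A1 where A1: "(f1 has_derivative A1) (at x)"
    using hol(1) U unfolding holomorphic_map_on_def by blast
  obtain B1 where B1: "(g1 has_derivative B1) (at z)" "Vector_Spaces.linear (*s) (*s) B1"
    using hol(2) zV unfolding holomorphic_map_on_def by blast
  obtain A2 where A2: "(f2 has_derivative A2) (at x)" "Vector_Spaces.linear (*s) (*s) A2"
    using hol(3) U unfolding holomorphic_map_on_def by blast
  obtain B2 where B2: "(g2 has_derivative B2) (at w)"
    using hol(4) wV unfolding holomorphic_map_on_def by blast
  define D where "D = A2 \<circ> B1"
  have D: "((f2 \<circ> g1) has_derivative D) (at z)"
    unfolding D_def using diff_chain_at[OF B1(1)] A2(1) g1z by simp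
  have lD: "Vector_Spaces.linear (*s) (*s) D"
    unfolding D_def using B1(2) A2(2) by (rule Vector_Spaces.linear_compose)
  define W where "W = V1 \<inter> g1 -` U2"
  have W: "open W"
    unfolding W_def using V(1) U(3) hom(1) continuous_on_open_vimage[OF V(1)]
    by (metis homeomorphism_def Int_commute)
  have zW: "z \<in> W" using zV g1z U by (simp add: W_def)
  have g1A: "f1 (g2 ((f2 \<circ> g1) y)) = y" if "y \<in> W" for y
    using that hom by (auto simp: W_def homeomorphism_def)
  have "((f1 \<circ> (g2 \<circ> (f2 \<circ> g1))) has_derivative (A1 \<circ> (B2 \<circ> D))) (at z)"
    using diff_chain_at[OF diff_chain_at[OF D, of g2 B2], of f1 A1] B2 A1 g1z g2w
    by (simp add: w_def)
  then have "((\<lambda>y. y) has_derivative (A1 \<circ> (B2 \<circ> D))) (at z)"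
    by (rule has_derivative_transform_within_open[OF _ W zW]) (use g1A in auto)
  then have "A1 \<circ> (B2 \<circ> D) = (\<lambda>y. y)"
    using has_derivative_ident has_derivative_unique by blast
  then have injD: "inj D"
    by (intro injI) (metis comp_apply)
  have DL: "D v \<in> L2" if v: "v \<in> L1" for v
  proof -
    have "((\<lambda>t::real. z + t *\<^sub>R v) has_derivative (\<lambda>t. t *\<^sub>R v)) (at 0)"
      by (auto intro!: derivative_eq_intros)
    then have "((f2 \<circ> g1) \<circ> (\<lambda>t::real. z + t *\<^sub>R v) has_derivative D \<circ> (\<lambda>t. t *\<^sub>R v)) (at 0)"
      by (rule diff_chain_at) (use D in simp)
    moreover have "D \<circ> (\<lambda>t. t *\<^sub>R v) = (\<lambda>t. t *\<^sub>R D v)"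
      using has_derivative_bounded_linear[OF D] by (auto simp: bounded_linear.linear linear_cmul)
    ultimately have "((f2 \<circ> g1) \<circ> (\<lambda>t::real. z + t *\<^sub>R v) has_vector_derivative D v) (at 0)"
      by (simp add: has_vector_derivative_def)
    then have "(\<lambda>t. norm (((f2 \<circ> g1) (z + t *\<^sub>R v) - (f2 \<circ> g1) z) - t *\<^sub>R D v) / norm t) \<midarrow>0\<rightarrow> 0"
      by (simp add: has_vector_derivative_def has_derivative_at)
    moreover have "norm (((f2 \<circ> g1) (z + t *\<^sub>R v) - (f2 \<circ> g1) z) - t *\<^sub>R D v) / norm t
        = norm (((f2 \<circ> g1) (z + t *\<^sub>R v) - (f2 \<circ> g1) z) /\<^sub>R t - D v)" if "t \<noteq> 0" for t :: real
    proof -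
      have "((f2 \<circ> g1) (z + t *\<^sub>R v) - (f2 \<circ> g1) z) /\<^sub>R t - D v
          = (((f2 \<circ> g1) (z + t *\<^sub>R v) - (f2 \<circ> g1) z) - t *\<^sub>R D v) /\<^sub>R t"
        using that by (simp add: scaleR_diff_right)
      then show ?thesis by (simp add: divide_inverse)
    qed
    ultimately have
      "(\<lambda>t. norm (((f2 \<circ> g1) (z + t *\<^sub>R v) - (f2 \<circ> g1) z) /\<^sub>R t - D v)) \<midarrow>0\<rightarrow> 0"
      by (subst (asm) LIM_cong[OF refl _ refl]) simp_all
    then have lim: "((\<lambda>t. ((f2 \<circ> g1) (z + t *\<^sub>R v) - (f2 \<circ> g1) z) /\<^sub>R t) \<longlongrightarrow> D v) (at 0)"
      using Lim_null tendsto_norm_zero_iff by blast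
    have scal: "t *\<^sub>R (u :: complex ^ 'm) = complex_of_real t *s u" for t u
      by (simp add: Finite_Cartesian_Product.vec_eq_iff scaleR_conv_of_real[where 'a = complex])
    have "((\<lambda>t::real. z + t *\<^sub>R v) \<longlongrightarrow> z + 0 *\<^sub>R v) (at 0)"
      by (intro tendsto_intros)
    then have "eventually (\<lambda>t. z + t *\<^sub>R v \<in> W) (at (0::real))"
      using W zW topological_tendstoD by fastforce
    then have "eventually (\<lambda>t. ((f2 \<circ> g1) (z + t *\<^sub>R v) - (f2 \<circ> g1) z) /\<^sub>R t \<in> L2) (at 0)"
    proof eventually_elim
      case (elim t)
      have key: "(f2 \<circ> g1) y \<in> L2" if "y \<in> W" "y \<in> L1" for y
      proof -
        have "y \<in> f1 ` (S \<inter> U1)" using that im by (auto simp: W_def)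
        then have "g1 y \<in> S" using hom(1) by (auto simp: homeomorphism_def)
        then show ?thesis using that im(2) by (auto simp: W_def)
      qed
      have "z + t *\<^sub>R v \<in> L1"
        unfolding scal by (intro vec.subspace_add vec.subspace_scale L(1) zL v)
      with elim key zW zL show ?case
        unfolding scal by (intro vec.subspace_diff vec.subspace_scale L(2) key)
    qed
    moreover have "closed L2"
    proof -
      have "subspace L2"
        unfolding subspace_def scal
        by (intro conjI ballI allI vec.subspace_0 vec.subspace_add vec.subspace_scale L(2))
      then show ?thesis by (rule closed_subspace)
    qed
    ultimately show ?thesis
      by (intro Lim_in_closed_set[OF _ _ _ lim]) simp_all
  qed
  have "vec.dim L1 = vec.dim (D ` L1)"
    by (rule vec.dim_image_eq[OF lD, symmetric]) (rule inj_on_subset[OF injD], simp)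
  also have "\<dots> \<le> vec.dim L2"
    by (rule vec.dim_subset) (use DL in blast)
  finally show ?thesis .
qed

lemma complex_submanifold_unique_le:
  assumes "x \<in> S" "complex_submanifold S d" "complex_submanifold S d'"
  shows "d \<le> d'"
  using bspec[OF assms(2)[unfolded complex_submanifold_def] assms(1)]
    bspec[OF assms(3)[unfolded complex_submanifold_def] assms(1)]
proof (elim exE conjE, goal_cases)
  case (1 U U' V V' f f' g g' L L')
  have "vec.dim L \<le> vec.dim L'"
    by (rule complex_submanifold_dim_le[of U x U' V V' f g f' g' L L' S]; fact 1 assms(1))
  then show ?case
    unfolding \<open>vec.dim L = d\<close> \<open>vec.dim L' = d'\<close> .
qed

lemma complex_dim_eq:
  assumes "S \<noteq> {}" "complex_submanifold S d"
  shows "complex_dim S = d"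
proof -
  from assms(1) obtain x where x: "x \<in> S" by blast
  show ?thesis
    unfolding complex_dim_def
    by (intro the_equality assms(2) antisym complex_submanifold_unique_le[OF x])
qed

text \<open>
  The coordinates of the matrix \<open>A\<close>, given a numbering \<open>e\<close> of the index type by \<open>0, \<dots>, n - 1\<close>.
\<close>

definition mat_coords :: "('n \<Rightarrow> nat) \<Rightarrow> complex mat \<Rightarrow> complex ^ ('n::finite \<times> 'n)" where
  "mat_coords e A = (\<chi> rc. A $$ (e (fst rc), e (snd rc)))"

definition similarity_class :: "nat \<Rightarrow> complex mat \<Rightarrow> complex mat set" where
  "similarity_class n J = {A \<in> carrier_mat n n. similar_mat A J}"

text \<open>
  Invariant polynomials via determinantal divisors: \<open>D\<^sub>k\<close> is the monic greatest common divisor of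
  the minors of order \<open>k\<close> of \<open>xI - A\<close> (so \<open>D\<^sub>0 = 1\<close>), and the \<open>j\<close>-th invariant polynomial of the
  \<open>n \<times> n\<close> matrix \<open>A\<close> is \<open>D\<^bsub>n-j+1\<^esub> / D\<^bsub>n-j\<^esub>\<close>, for \<open>1 \<le> j \<le> n\<close>. The one with \<open>j = 1\<close> is the minimal
  polynomial.
\<close>

definition det_divisor :: "complex mat \<Rightarrow> nat \<Rightarrow> complex poly" where
  "det_divisor A k =
     Gcd {Determinant.det (submatrix (char_poly_matrix A) I K) | I K.
            I \<subseteq> {..<dim_row A} \<and> K \<subseteq> {..<dim_col A} \<and> card I = k \<and> card K = k}"

definition invariant_poly :: "complex mat \<Rightarrow> nat \<Rightarrow> complex poly" where
  "invariant_poly A j = det_divisor A (dim_row A - j + 1) div det_divisor A (dim_row A - j)"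

end

theory Submission
  imports Defs
begin

text \<open>
  Similarity classes are conjugacy classes in a finite-dimensional algebra. Put
  \<open>ad a x = x a - a x\<close>, choose a linear right inverse \<open>g\<close> of \<open>ad a\<close> on its range, and let
  \<open>P = ad a \<circ> g\<close>, a projection onto that range. The map
  \<open>w \<mapsto> ((1 + g w) a + (w - P w)) (1 + g w)\<^bsup>-1\<^esup>\<close> has derivative \<open>1\<close> at \<open>0\<close>, hence is locally invertible, and
  near \<open>0\<close> its value \<open>b\<close> is conjugate to \<open>a\<close> exactly if \<open>w\<close> lies in the range of \<open>ad a\<close>. For the
  nontrivial direction, \<open>x \<mapsto> b x - x a\<close> has the same rank as \<open>ad a\<close> if \<open>b\<close> is conjugate to \<open>a\<close>, so near \<open>a\<close>
  its range meets the kernel of \<open>P\<close> only in \<open>0\<close>; but \<open>w - P w\<close> belongs to both. So the class is a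
  submanifold whose dimension is the rank of \<open>ad a\<close>. For a Jordan matrix the kernel of \<open>ad a\<close> consists of
  Toeplitz blocks, with \<open>min k k'\<close> free entries for each ordered pair of blocks of orders \<open>k\<close>, \<open>k'\<close> with the same
  eigenvalue.

  For the invariant polynomials, view the terms of a minor of \<open>xI - J\<close> as matchings between its rows
  and columns. A block none of whose rows is deleted must be matched along its diagonal, so after deleting
  \<open>j\<close> rows at least the product over all but \<open>j\<close> blocks survives in each term. Conversely, deleting the
  last rows and the first columns of the \<open>j\<close> largest blocks for an eigenvalue leaves only one
  matching, so the corresponding minor attains the minimal multiplicity of that eigenvalue.
\<close>

section \<open>Conjugacy classes in finite-dimensional algebras\<close>

lemma scaleR_eq_smult: "t *\<^sub>R (u :: complex ^ 'm) = complex_of_real t *s u"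
  by (simp add: Finite_Cartesian_Product.vec_eq_iff scaleR_conv_of_real[where 'a = complex])

lemma vec_linear_imp_bounded_linear:
  fixes f :: "complex ^ 'm \<Rightarrow> complex ^ 'k"
  assumes "Vector_Spaces.linear (*s) (*s) f"
  shows "bounded_linear f"
proof -
  interpret Vector_Spaces.linear "(*s)" "(*s)" f by (rule assms)
  show ?thesis
    by (rule linear_conv_bounded_linear[THEN iffD1], rule linearI) (simp_all add: add scale scaleR_eq_smult)
qed

text \<open>Rank and nullity: for a linear right inverse \<open>g\<close> of \<open>f\<close> on its
  range, \<open>x = g (f x) + (x - g (f x))\<close> splits the space into a copy of the range and
  the kernel.\<close>

lemma vec_dim_range_plus_kernel:
  fixes f :: "complex ^ 'm \<Rightarrow> complex ^ 'k"
  assumes lf: "Vector_Spaces.linear (*s) (*s) f"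
  shows "vec.dim (range f) + vec.dim {x. f x = 0} = CARD('m)"
proof -
  interpret f: Vector_Spaces.linear "(*s)" "(*s)" f by (rule lf)
  have sub: "vec.subspace {x. f x = 0}"
    by (simp add: vec.subspace_def f.add f.scale)
  obtain g where g: "Vector_Spaces.linear (*s) (*s) g" and fg: "\<forall>v\<in>range f. f (g v) = v"
    using vec.linear_exists_right_inverse_on[OF lf vec.subspace_UNIV] by blast
  interpret g: Vector_Spaces.linear "(*s)" "(*s)" g by (rule g)
  have rsub: "vec.subspace (range f)" by (rule f.subspace_image) simp
  define T where "T = g ` range f"
  have T: "vec.subspace T" unfolding T_def by (rule g.subspace_image[OF rsub])
  have "inj_on g (range f)" by (rule inj_on_inverseI[of _ f]) (use fg in auto)
  then have dT: "vec.dim T = vec.dim (range f)"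
    unfolding T_def using vec.dim_image_eq[OF g] by (metis rsub vec.span_eq_iff)
  have int: "T \<inter> {x. f x = 0} = {0}"
    using fg T by (auto simp: T_def g.zero dest: vec.subspace_0)
  have "{x + y |x y. x \<in> T \<and> y \<in> {x. f x = 0}} = UNIV"
  proof -
    have "x = g (f x) + (x - g (f x)) \<and> g (f x) \<in> T \<and> f (x - g (f x)) = 0" for x
      using fg by (auto simp: T_def f.diff)
    then show ?thesis by blast
  qed
  then show ?thesis
    using vec.dim_sums_Int[OF T sub] int dT vec.dim_UNIV by (simp add: card_cart_basis)
qed

text \<open>The two identities give one inclusion each. Both ranks below are transported along
  multiplication by a unit in this way, with \<open>p\<close> and \<open>q\<close> read off from the
  conjugation.\<close>

lemma range_eq_image_range:
  assumes "\<And>x. f x = h (k (p x))" "\<And>x. h (k x) = f (q x)"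
  shows "range f = h ` range k"
  using assms by (auto simp: image_image)

text \<open>The algebra lives on \<open>complex ^ 'm\<close>, so that derivatives and
  \<open>vec.dim\<close> apply to it directly; matrices enter as an instance.\<close>

locale complex_algebra =
  fixes times :: "complex ^ 'm \<Rightarrow> complex ^ 'm \<Rightarrow> complex ^ 'm" (infixl "\<star>" 70)
    and one :: "complex ^ 'm"
  assumes add_left: "(x + y) \<star> z = x \<star> z + y \<star> z"
    and add_right: "x \<star> (y + z) = x \<star> y + x \<star> z"
    and scale_left: "(c *s x) \<star> y = c *s (x \<star> y)"
    and scale_right: "x \<star> (c *s y) = c *s (x \<star> y)"
    and assoc: "(x \<star> y) \<star> z = x \<star> (y \<star> z)"
    and one_left: "one \<star> x = x" and one_right: "x \<star> one = x"
begin

lemma linear_left: "Vector_Spaces.linear (*s) (*s) (\<lambda>x. x \<star> y)"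
  by unfold_locales (simp_all add: add_left scale_left)

lemma linear_right: "Vector_Spaces.linear (*s) (*s) (\<lambda>y. x \<star> y)"
  by unfold_locales (simp_all add: add_right scale_right)

sublocale times: bounded_bilinear "(\<star>)"
proof -
  have "bilinear (\<star>)"
    unfolding bilinear_def
    using vec_linear_imp_bounded_linear[OF linear_left] vec_linear_imp_bounded_linear[OF linear_right]
    by (auto simp: bounded_linear.linear)
  then show "bounded_bilinear (\<star>)" by (rule bilinear_conv_bounded_bilinear[THEN iffD1])
qed

definition conj_class :: "complex ^ 'm \<Rightarrow> (complex ^ 'm) set" where
  "conj_class a = {b. \<exists>t u. t \<star> u = one \<and> u \<star> t = one \<and> b = t \<star> a \<star> u}"

definition ad :: "complex ^ 'm \<Rightarrow> complex ^ 'm \<Rightarrow> complex ^ 'm" where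
  "ad a x = x \<star> a - a \<star> x"

text \<open>A total function, so that it can be differentiated; its value at a non-unit is
  arbitrary.\<close>

definition unit_inv :: "complex ^ 'm \<Rightarrow> complex ^ 'm" where
  "unit_inv x = (SOME y. x \<star> y = one \<and> y \<star> x = one)"

lemma linear_ad: "Vector_Spaces.linear (*s) (*s) (ad a)"
  unfolding ad_def
  by unfold_locales (simp_all add: add_left add_right scale_left scale_right algebra_simps
      vec.scale_right_diff_distrib)

section \<open>Inversion near the unit element\<close>

lemma left_inverse_eq: "x \<star> y = one \<Longrightarrow> z \<star> x = one \<Longrightarrow> y = z"
  by (metis assoc one_left one_right)

text \<open>If \<open>K\<close> bounds the product and \<open>norm x < 1 / (2 * K)\<close>,
  multiplication by \<open>x\<close> on either side at least halves norms. Hence both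
  multiplications by \<open>one + x\<close> are injective, and surjective by finite dimension; the
  one-sided inverses obtained agree.\<close>

lemma unit_near_one:
  obtains r where "r > 0" "\<And>x. norm x < r \<Longrightarrow> \<exists>y. (one + x) \<star> y = one \<and> y \<star> (one + x) = one"
proof -
  obtain K where K: "K > 0" "\<And>x y. norm (x \<star> y) \<le> norm x * norm y * K"
    using times.pos_bounded by blast
  have small: "norm (x \<star> y) \<le> norm y / 2" "norm (y \<star> x) \<le> norm y / 2" if "norm x < 1 / (2 * K)" for x y
  proof -
    have "norm x * K \<le> 1 / 2" using that K(1) by (simp add: field_simps)
    then have "norm y * (norm x * K) \<le> norm y * (1/2)"
      by (rule mult_left_mono) simp
    then show "norm (x \<star> y) \<le> norm y / 2" "norm (y \<star> x) \<le> norm y / 2"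
      using K(2)[of x y] K(2)[of y x] by (auto simp: mult.commute mult.left_commute)
  qed
  show ?thesis
  proof (rule that[of "1 / (2 * K)"])
    show "1 / (2 * K) > 0" using K by simp
    fix x :: "complex ^ 'm" assume x: "norm x < 1 / (2 * K)"
    have inj1: "y = 0" if "(one + x) \<star> y = 0" for y
    proof -
      have "y = - (x \<star> y)" using that by (simp add: add_left one_left eq_neg_iff_add_eq_0)
      then have "norm y \<le> norm y / 2" using small(1)[OF x, of y] by (metis norm_minus_cancel)
      then show ?thesis by simp
    qed
    have inj2: "y = 0" if "y \<star> (one + x) = 0" for y
    proof -
      have "y = - (y \<star> x)" using that by (simp add: add_right one_right eq_neg_iff_add_eq_0)
      then have "norm y \<le> norm y / 2" using small(2)[OF x, of y] by (metis norm_minus_cancel)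
      then show ?thesis by simp
    qed
    have "surj (\<lambda>y. (one + x) \<star> y)"
      using inj1 bounded_linear.linear[OF times.bounded_linear_right]
      by (intro linear_injective_imp_surjective) (auto simp: linear_injective_0)
    then obtain y where y: "(one + x) \<star> y = one" by (metis surjD)
    have "surj (\<lambda>y. y \<star> (one + x))"
      using inj2 bounded_linear.linear[OF times.bounded_linear_left]
      by (intro linear_injective_imp_surjective) (auto simp: linear_injective_0)
    then obtain z where z: "z \<star> (one + x) = one" by (metis surjD)
    show "\<exists>y. (one + x) \<star> y = one \<and> y \<star> (one + x) = one"
      using y z left_inverse_eq by metis
  qed
qed

lemma unit_inv_unique:
  assumes "x \<star> y = one" "y \<star> x = one"
  shows "unit_inv x = y"
  unfolding unit_inv_def by (rule some_equality) (use assms left_inverse_eq in blast)+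

text \<open>Everything rests on the identity
  \<open>i y - i x = - (i y \<star> (y - x) \<star> i x)\<close>. Together with a uniform bound on
  the inverses it shows that \<open>i\<close> is Lipschitz, and used a second time it shows that the
  linear approximation has a quadratic error.\<close>

lemma unit_inv_near_one:
  obtains r where "r > 0"
    "\<And>x. norm x < r \<Longrightarrow> (one + x) \<star> unit_inv (one + x) = one"
    "\<And>x. norm x < r \<Longrightarrow> unit_inv (one + x) \<star> (one + x) = one"
    "\<And>x. norm x < r \<Longrightarrow> ((\<lambda>x. unit_inv (one + x)) has_derivative
        (\<lambda>h. - (unit_inv (one + x) \<star> h \<star> unit_inv (one + x)))) (at x)"
proof -
  obtain r0 where r0: "r0 > 0" "\<And>x. norm x < r0 \<Longrightarrow> \<exists>y. (one + x) \<star> y = one \<and> y \<star> (one + x) = one"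
    using unit_near_one by blast
  obtain K where K: "K > 0" "\<And>x y. norm (x \<star> y) \<le> norm x * norm y * K"
    using times.pos_bounded by blast
  define i where "i x = unit_inv (one + x)" for x :: "complex ^ 'm"
  define r where "r = min r0 (1 / (2 * K))"
  have r: "r > 0" using r0 K by (simp add: r_def)
  have i: "(one + x) \<star> i x = one" "i x \<star> (one + x) = one" if "norm x < r" for x :: "complex ^ 'm"
    using r0(2)[of x] that unit_inv_unique by (auto simp: i_def r_def)
  define C where "C = 2 * norm one"
  \<comment> \<open>In \<open>i x = one - x \<star> i x\<close> the last term has norm at most half
    of \<open>norm (i x)\<close> and is absorbed on the left.\<close>
  have bound: "norm (i x) \<le> C" if x: "norm x < r" for x
  proof -
    have "i x = one - x \<star> i x" using i(1)[OF x] by (simp add: add_left one_left algebra_simps)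
    then have "norm (i x) \<le> norm one + norm (x \<star> i x)" by (metis norm_triangle_ineq4)
    also have "norm (x \<star> i x) \<le> (norm x * K) * norm (i x)"
      using K(2)[of x "i x"] by (simp add: mult_ac)
    also have "\<dots> \<le> 1 / 2 * norm (i x)"
      by (rule mult_right_mono) (use x K in \<open>auto simp: r_def field_simps\<close>)
    finally show ?thesis by (simp add: C_def)
  qed
  have C0: "C \<ge> 0" by (simp add: C_def)
  have diff: "i y - i x = - (i y \<star> (y - x) \<star> i x)" if "norm x < r" "norm y < r" for x y
  proof -
    have "i y \<star> (y - x) \<star> i x = i y \<star> ((one + y) - (one + x)) \<star> i x" by simp
    also have "\<dots> = i y \<star> (one + y) \<star> i x - i y \<star> ((one + x) \<star> i x)"
      unfolding times.diff_right times.diff_left assoc ..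
    also have "\<dots> = i x - i y"
      unfolding i(1)[OF that(1)] i(2)[OF that(2)] by (simp add: one_left one_right)
    finally show ?thesis by simp
  qed
  define D where "D = C * K * C * K"
  have lip: "norm (i y - i x) \<le> D * norm (y - x)" if "norm x < r" "norm y < r" for x y
  proof -
    have "norm (i y - i x) \<le> norm (i y \<star> (y - x)) * norm (i x) * K"
      unfolding diff[OF that] using K(2) by simp
    also have "\<dots> \<le> (norm (i y) * norm (y - x) * K) * norm (i x) * K"
      by (intro mult_right_mono K) (use K in auto)
    also have "\<dots> \<le> (C * norm (y - x) * K) * C * K"
      by (intro mult_mono bound that mult_nonneg_nonneg) (use K C0 in auto)
    finally show ?thesis by (simp add: D_def mult_ac)
  qed
  have D0: "D \<ge> 0" using K C0 by (simp add: D_def)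
  have deriv: "(i has_derivative (\<lambda>h. - (i x \<star> h \<star> i x))) (at x)" if x: "norm x < r" for x
  proof (rule has_derivativeI)
    show "bounded_linear (\<lambda>h. - (i x \<star> h \<star> i x))"
      by (intro bounded_linear_minus bounded_linear_compose[OF times.bounded_linear_left]
          times.bounded_linear_right)
    define E where "E = D * K * C * K"
    \<comment> \<open>Substituting \<open>diff\<close> for the first difference leaves
      \<open>- ((i y - i x) \<star> (y - x) \<star> i x)\<close>, to which \<open>lip\<close>
      applies.\<close>
    have rem: "norm ((i y - i x) + (i x \<star> (y - x) \<star> i x)) \<le> E * norm (y - x) * norm (y - x)"
      if y: "norm y < r" for y
    proof -
      have "(i y - i x) + (i x \<star> (y - x) \<star> i x) = - ((i y - i x) \<star> (y - x) \<star> i x)"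
        unfolding times.diff_left unfolding diff[OF x y] by simp
      then have "norm ((i y - i x) + (i x \<star> (y - x) \<star> i x)) = norm ((i y - i x) \<star> (y - x) \<star> i x)"
        by simp
      also have "\<dots> \<le> norm ((i y - i x) \<star> (y - x)) * norm (i x) * K" by (rule K)
      also have "\<dots> \<le> (norm (i y - i x) * norm (y - x) * K) * norm (i x) * K"
        by (intro mult_right_mono K) (use K in auto)
      also have "\<dots> \<le> (D * norm (y - x) * norm (y - x) * K) * C * K"
        by (intro mult_mono bound lip x y mult_nonneg_nonneg) (use K C0 D0 in auto)
      finally show ?thesis by (simp add: E_def mult_ac)
    qed
    have "((\<lambda>y. E * norm (y - x)) \<longlongrightarrow> E * norm (x - x)) (at x)"
      by (intro tendsto_intros)
    then have lim: "((\<lambda>y. E * norm (y - x)) \<longlongrightarrow> 0) (at x)" by simp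
    have ev: "eventually (\<lambda>y. norm y < r) (at x)"
    proof -
      have "((\<lambda>y. norm y) \<longlongrightarrow> norm x) (at x)" by (intro tendsto_intros)
      then show ?thesis using x by (rule order_tendstoD)
    qed
    show "((\<lambda>y. ((i y - i x) - - (i x \<star> (y - x) \<star> i x)) /\<^sub>R norm (y - x)) \<longlongrightarrow> 0) (at x)"
    proof (rule tendsto_norm_zero_cancel, rule tendsto_sandwich[OF _ _ tendsto_const lim])
      show "\<forall>\<^sub>F y in at x. norm (((i y - i x) - - (i x \<star> (y - x) \<star> i x)) /\<^sub>R norm (y - x)) \<le> E * norm (y - x)"
        using ev
      proof eventually_elim
        case (elim y)
        then show ?case using rem[OF elim]
          by (cases "y = x") (auto simp: divide_inverse_commute[symmetric] pos_divide_le_eq)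
      qed
    qed simp
  qed
  show ?thesis
    by (rule that[OF r]) (use i deriv in \<open>auto simp: i_def[abs_def]\<close>)
qed

section \<open>Conjugacy classes and ranks of commutator maps\<close>

lemma conj_class_refl: "a \<in> conj_class a"
  unfolding conj_class_def using one_left one_right by (auto intro!: exI[of _ one])

lemma conj_class_eq:
  assumes "b \<in> conj_class a"
  shows "conj_class b = conj_class a"
proof -
  have sub: "conj_class b \<subseteq> conj_class a" if ba: "b \<in> conj_class a" for a b
  proof
    fix c assume "c \<in> conj_class b"
    then obtain t u where tu: "t \<star> u = one" "u \<star> t = one" "c = t \<star> b \<star> u"
      by (auto simp: conj_class_def)
    obtain t' u' where tu': "t' \<star> u' = one" "u' \<star> t' = one" "b = t' \<star> a \<star> u'"
      using ba unfolding conj_class_def by blast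
    have "(t \<star> t') \<star> (u' \<star> u) = t \<star> (t' \<star> u') \<star> u" "(u' \<star> u) \<star> (t \<star> t') = u' \<star> (u \<star> t) \<star> t'"
      by (simp_all only: assoc)
    then have "(t \<star> t') \<star> (u' \<star> u) = one" "(u' \<star> u) \<star> (t \<star> t') = one"
      by (simp_all add: tu tu' one_left one_right)
    moreover have "c = (t \<star> t') \<star> a \<star> (u' \<star> u)" by (simp add: tu tu' assoc)
    ultimately show "c \<in> conj_class a" unfolding conj_class_def by blast
  qed
  obtain t u where tu: "t \<star> u = one" "u \<star> t = one" "b = t \<star> a \<star> u"
    using assms by (auto simp: conj_class_def)
  have "u \<star> b \<star> t = (u \<star> t) \<star> a \<star> (u \<star> t)" by (simp add: tu(3) assoc)
  then have "a = u \<star> b \<star> t" by (simp add: tu(2) one_left one_right)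
  then have "a \<in> conj_class b" unfolding conj_class_def using tu by blast
  then show ?thesis using sub assms by blast
qed

text \<open>For \<open>x = t \<star> y\<close> the expression
  \<open>b \<star> x - x \<star> a\<close> equals \<open>- (t \<star> ad a y)\<close>, and left
  multiplication by the unit \<open>t\<close> is injective. This mixed commutator detects conjugacy
  to \<open>a\<close> in the chart below.\<close>

lemma dim_range_conj_left:
  assumes t: "t \<star> u = one" "u \<star> t = one" and b: "b = t \<star> a \<star> u"
  shows "vec.dim (range (\<lambda>x. b \<star> x - x \<star> a)) = vec.dim (range (ad a))"
proof -
  have r1: "range (\<lambda>x. b \<star> x - x \<star> a) = (\<star>) t ` range (ad a)"
  proof -
    have "b \<star> x - x \<star> a = t \<star> ad a (- (u \<star> x))" for x
    proof -
      have "t \<star> ad a (- (u \<star> x)) = t \<star> a \<star> u \<star> x - (t \<star> u) \<star> x \<star> a"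
        by (simp add: ad_def times.diff_right times.minus_left times.minus_right assoc)
      then show ?thesis by (simp add: t b one_left)
    qed
    moreover have "t \<star> ad a x = b \<star> (- (t \<star> x)) - (- (t \<star> x)) \<star> a" for x
    proof -
      have "b \<star> (- (t \<star> x)) - (- (t \<star> x)) \<star> a = t \<star> x \<star> a - t \<star> a \<star> (u \<star> t) \<star> x"
        by (simp add: b times.minus_left times.minus_right assoc)
      then show ?thesis by (simp add: t ad_def times.diff_right one_right assoc)
    qed
    ultimately show ?thesis by (rule range_eq_image_range)
  qed
  have "inj ((\<star>) t)" by (rule inj_on_inverseI[of _ "(\<star>) u"]) (simp add: assoc[symmetric] t one_left)
  then have "vec.dim ((\<star>) t ` range (ad a)) = vec.dim (range (ad a))"
    by (intro vec.dim_image_eq[OF linear_right]) (rule inj_on_subset, auto)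
  then show ?thesis by (simp add: r1)
qed

text \<open>Right multiplication by \<open>u\<close> carries the range of the mixed commutator onto
  the range of \<open>ad b\<close>. Thus the dimension of the chart space is the same at all points
  of the class.\<close>

lemma dim_range_ad_conj:
  assumes "b \<in> conj_class a"
  shows "vec.dim (range (ad b)) = vec.dim (range (ad a))"
proof -
  obtain t u where t: "t \<star> u = one" "u \<star> t = one" and b: "b = t \<star> a \<star> u"
    using assms by (auto simp: conj_class_def)
  have r: "range (ad b) = (\<lambda>y. y \<star> u) ` range (\<lambda>x. b \<star> x - x \<star> a)"
  proof -
    have "ad b x = (b \<star> (- (x \<star> t)) - (- (x \<star> t)) \<star> a) \<star> u" for x
    proof -
      have "(b \<star> (- (x \<star> t)) - (- (x \<star> t)) \<star> a) \<star> u = x \<star> (t \<star> a \<star> u) - b \<star> x \<star> (t \<star> u)"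
        by (simp add: times.minus_left times.minus_right times.diff_left assoc)
      then show ?thesis by (simp add: t ad_def b[symmetric] one_right)
    qed
    moreover have "(b \<star> x - x \<star> a) \<star> u = ad b (- (x \<star> u))" for x
    proof -
      have "ad b (- (x \<star> u)) = b \<star> x \<star> u - x \<star> (u \<star> t) \<star> a \<star> u"
        by (simp add: ad_def b times.minus_left times.minus_right assoc)
      then show ?thesis by (simp add: t times.diff_left one_right assoc)
    qed
    ultimately show ?thesis by (rule range_eq_image_range)
  qed
  have "inj (\<lambda>y. y \<star> u)" by (rule inj_on_inverseI[of _ "\<lambda>y. y \<star> t"]) (simp add: assoc t one_right)
  then have "vec.dim ((\<lambda>y. y \<star> u) ` range (\<lambda>x. b \<star> x - x \<star> a)) = vec.dim (range (\<lambda>x. b \<star> x - x \<star> a))"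
    by (intro vec.dim_image_eq[OF linear_left]) (rule inj_on_subset, auto)
  then show ?thesis using dim_range_conj_left[OF t b] by (simp add: r)
qed

text \<open>The chart \<open>\<phi>\<close> is the local inverse at \<open>a\<close> of the map
  \<open>\<Phi>\<close> constructed in the proof; the range of \<open>ad a\<close> is the tangent
  space of the class at \<open>a\<close>.\<close>

lemma conj_class_chart:
  obtains U V \<phi> \<psi> where "open U" "a \<in> U" "open V" "homeomorphism U V \<phi> \<psi>"
    "holomorphic_map_on \<phi> U" "holomorphic_map_on \<psi> V"
    "\<phi> ` (conj_class a \<inter> U) = V \<inter> range (ad a)"
proof -
  interpret ad: Vector_Spaces.linear "(*s)" "(*s)" "ad a" by (rule linear_ad)
  obtain g where g: "Vector_Spaces.linear (*s) (*s) g" and adg: "\<forall>v\<in>range (ad a). ad a (g v) = v"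
    using vec.linear_exists_right_inverse_on[OF linear_ad vec.subspace_UNIV] by blast
  interpret g: Vector_Spaces.linear "(*s)" "(*s)" g by (rule g)
  define P where "P v = ad a (g v)" for v
  have lP: "Vector_Spaces.linear (*s) (*s) P"
    unfolding P_def by unfold_locales (simp_all add: g.add g.scale ad.add ad.scale)
  interpret P: Vector_Spaces.linear "(*s)" "(*s)" P by (rule lP)
  have P_id: "P v = v" if "v \<in> range (ad a)" for v
    unfolding P_def using adg that by (rule bspec)
  have P_range: "P v \<in> range (ad a)" for v by (simp add: P_def)
  have PP: "P (P v) = P v" for v by (rule P_id[OF P_range])
  interpret bg: bounded_linear g by (rule vec_linear_imp_bounded_linear[OF g])
  interpret bP: bounded_linear P by (rule vec_linear_imp_bounded_linear[OF lP])
  obtain r where r: "r > 0"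
    and i1: "\<And>x. norm x < r \<Longrightarrow> (one + x) \<star> unit_inv (one + x) = one"
    and i2: "\<And>x. norm x < r \<Longrightarrow> unit_inv (one + x) \<star> (one + x) = one"
    and i': "\<And>x. norm x < r \<Longrightarrow> ((\<lambda>x. unit_inv (one + x)) has_derivative
        (\<lambda>h. - (unit_inv (one + x) \<star> h \<star> unit_inv (one + x)))) (at x)"
    using unit_inv_near_one by metis
  define u where "u w = unit_inv (one + g w)" for w
  \<comment> \<open>On the range of \<open>ad a\<close> the term \<open>w - P w\<close> vanishes and
    only a conjugate of \<open>a\<close> remains; in the complementary directions this term moves
    the point out of the class.\<close>
  define \<Phi> where "\<Phi> w = ((one + g w) \<star> a + (w - P w)) \<star> u w" for w
  define \<Phi>' where "\<Phi>' w h = ((one + g w) \<star> a + (w - P w)) \<star> (- (u w \<star> g h \<star> u w))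
      + (g h \<star> a + (h - P h)) \<star> u w" for w h
  define U0 where "U0 = {w. norm (g w) < r}"
  have U0: "open U0"
    unfolding U0_def by (intro open_Collect_less continuous_intros bg.continuous_on)
  have u_deriv: "(u has_derivative (\<lambda>h. - (u w \<star> g h \<star> u w))) (at w)" if "w \<in> U0" for w
    using has_derivative_compose[OF bg.has_derivative[OF has_derivative_ident] i'[of "g w"]] that
    by (simp add: U0_def u_def[abs_def])
  have \<Phi>_deriv: "(\<Phi> has_derivative \<Phi>' w) (at w)" if "w \<in> U0" for w
  proof -
    have "((\<lambda>w. (one + g w) \<star> a + (w - P w)) has_derivative (\<lambda>h. g h \<star> a + (h - P h))) (at w)"
      by (auto intro!: derivative_eq_intros bg.has_derivative bP.has_derivative
          bounded_linear.has_derivative[OF times.bounded_linear_left])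
    from times.FDERIV[OF this u_deriv[OF that]] show ?thesis
      by (simp add: \<Phi>_def[abs_def] \<Phi>'_def[abs_def])
  qed
  have u_cont: "continuous_on U0 u"
    using u_deriv by (meson continuous_at_imp_continuous_on has_derivative_continuous)
  have \<Phi>_cont: "continuous_on U0 \<Phi>"
    using \<Phi>_deriv by (meson continuous_at_imp_continuous_on has_derivative_continuous)
  have u0: "u 0 = one" by (simp add: u_def g.zero unit_inv_unique one_left)
  have \<Phi>0: "\<Phi> 0 = a" by (simp add: \<Phi>_def u0 g.zero P.zero one_left one_right)
  have zero_U0: "0 \<in> U0" using r by (simp add: U0_def g.zero)
  \<comment> \<open>At \<open>0\<close> the derivative is \<open>ad a (g h) + (h - P h)\<close>,
    where the first summand is \<open>P h\<close> by definition.\<close>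
  have \<Phi>'0: "\<Phi>' 0 h = h" for h
    by (simp add: \<Phi>'_def u0 g.zero P.zero one_left one_right P_def ad_def times.minus_right
        times.zero_left times.zero_right)

  \<comment> \<open>On the range of \<open>ad a\<close>, \<open>M a\<close> is minus the identity.
    Replacing \<open>a\<close> by \<open>b\<close> changes it by at most the factor
    \<open>norm (b - a) * (Kg * K * KP)\<close>, so it stays injective as long as this factor is
    below 1.\<close>
  define M where "M b w = P (b \<star> g w - g w \<star> a)" for b w
  obtain \<epsilon> where \<epsilon>: "\<epsilon> > 0"
    "\<And>b w. norm (b - a) < \<epsilon> \<Longrightarrow> w \<in> range (ad a) \<Longrightarrow> M b w = 0 \<Longrightarrow> w = 0"
  proof -
    obtain K where K: "K > 0" "\<And>x y. norm (x \<star> y) \<le> norm x * norm y * K"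
      using times.pos_bounded by blast
    obtain Kg where Kg: "Kg > 0" "\<And>x. norm (g x) \<le> norm x * Kg" using bg.pos_bounded by blast
    obtain KP where KP: "KP > 0" "\<And>x. norm (P x) \<le> norm x * KP" using bP.pos_bounded by blast
    show ?thesis
    proof (rule that[of "1 / (Kg * K * KP)"])
      show "1 / (Kg * K * KP) > 0" using K Kg KP by simp
      fix b w assume b: "norm (b - a) < 1 / (Kg * K * KP)" and w: "w \<in> range (ad a)" and M: "M b w = 0"
      have "b \<star> g w - g w \<star> a = (b - a) \<star> g w - ad a (g w)"
        by (simp add: ad_def times.diff_left)
      then have "P ((b - a) \<star> g w) = P (P w)"
        using M unfolding M_def by (metis P.diff P_def eq_iff_diff_eq_0)
      then have "w = P ((b - a) \<star> g w)" by (simp add: PP P_id[OF w])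
      then have "norm w \<le> norm ((b - a) \<star> g w) * KP" using KP(2) by metis
      also have "\<dots> \<le> (norm (b - a) * norm (g w) * K) * KP"
        by (intro mult_right_mono K) (use KP in auto)
      also have "\<dots> \<le> (norm (b - a) * (norm w * Kg) * K) * KP"
        by (intro mult_right_mono mult_left_mono Kg) (use KP K in auto)
      finally have "norm w \<le> (norm (b - a) * (Kg * K * KP)) * norm w" by (simp add: mult_ac)
      moreover have "norm (b - a) * (Kg * K * KP) < 1"
        using b K Kg KP by (simp add: field_simps)
      ultimately have "\<not> 0 < norm w"
        using mult_strict_right_mono[of "norm (b - a) * (Kg * K * KP)" 1 "norm w"] by linarith
      then show "w = 0" by simp
    qed
  qed

  define U1 where "U1 = U0 \<inter> \<Phi> -` ball a \<epsilon>"
  have U1: "open U1" "0 \<in> U1" "U1 \<subseteq> U0"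
    unfolding U1_def using continuous_open_preimage[OF \<Phi>_cont U0] \<epsilon>(1) zero_U0 \<Phi>0 by auto

  have in_class: "\<Phi> w \<in> conj_class a \<longleftrightarrow> w \<in> range (ad a)" if w: "w \<in> U1" for w
  proof
    have wr: "norm (g w) < r" using w U1(3) by (auto simp: U0_def)
    note inv = i1[OF wr, folded u_def] i2[OF wr, folded u_def]
    {
      assume "w \<in> range (ad a)"
      then have "\<Phi> w = (one + g w) \<star> a \<star> u w" by (simp add: \<Phi>_def P_id)
      then show "\<Phi> w \<in> conj_class a" unfolding conj_class_def using inv by blast
    }
    assume "\<Phi> w \<in> conj_class a"
    then obtain t v where t: "t \<star> v = one" "v \<star> t = one" and b: "\<Phi> w = t \<star> a \<star> v"
      by (auto simp: conj_class_def)
    \<comment> \<open>Under the assumed conjugacy \<open>L\<close> has the same rank as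
      \<open>ad a\<close>, by \<open>dim_range_conj_left\<close>.\<close>
    define L where "L x = \<Phi> w \<star> x - x \<star> a" for x
    have lL: "Vector_Spaces.linear (*s) (*s) L"
      unfolding L_def
      by unfold_locales (simp_all add: add_left add_right scale_left scale_right algebra_simps
          vec.scale_right_diff_distrib)
    interpret L: Vector_Spaces.linear "(*s)" "(*s)" L by (rule lL)
    have lLg: "Vector_Spaces.linear (*s) (*s) (\<lambda>x. L (g x))"
      by unfold_locales (simp_all add: g.add g.scale L.add L.scale)
    interpret Lg: Vector_Spaces.linear "(*s)" "(*s)" "\<lambda>x. L (g x)" by (rule lLg)
    have rsub: "vec.subspace (range (ad a))" by (rule ad.subspace_image) simp
    have near: "norm (\<Phi> w - a) < \<epsilon>" using w by (simp add: U1_def dist_norm norm_minus_commute)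
    have inj: "x = 0" if "x \<in> range (ad a)" "P (L (g x)) = 0" for x
      using \<epsilon>(2)[OF near that(1)] that(2) by (simp add: M_def L_def)
    have "inj_on (\<lambda>x. L (g x)) (range (ad a))"
    proof (rule inj_onI)
      fix x y assume xy: "x \<in> range (ad a)" "y \<in> range (ad a)" "L (g x) = L (g y)"
      then have "x - y \<in> range (ad a)" "L (g (x - y)) = 0"
        using vec.subspace_diff[OF rsub] by (simp_all add: g.diff L.diff)
      then have "x - y = 0" using inj P.zero by metis
      then show "x = y" by simp
    qed
    then have "vec.dim ((\<lambda>x. L (g x)) ` range (ad a)) = vec.dim (range (ad a))"
      by (intro vec.dim_image_eq[OF lLg]) (use rsub vec.span_eq_iff in metis)
    then have "vec.dim (range L) = vec.dim ((\<lambda>x. L (g x)) ` range (ad a))"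
      using dim_range_conj_left[OF t b] by (simp add: L_def[abs_def])
    moreover have "vec.subspace ((\<lambda>x. L (g x)) ` range (ad a))"
      by (rule Lg.subspace_image[OF rsub])
    moreover have "vec.subspace (range L)" by (rule L.subspace_image) simp
    \<comment> \<open>\<open>L \<circ> g\<close> is injective on the range of \<open>ad a\<close>
      because even \<open>P \<circ> L \<circ> g\<close> is; equality of dimensions then makes its
      image all of \<open>range L\<close>.\<close>
    ultimately have rL: "(\<lambda>x. L (g x)) ` range (ad a) = range L"
      by (intro vec.subspace_dim_equal) auto
    have "\<Phi> w \<star> (one + g w) = ((one + g w) \<star> a + (w - P w)) \<star> (u w \<star> (one + g w))"
      by (simp only: \<Phi>_def assoc)
    \<comment> \<open>So \<open>w - P w\<close> lies in \<open>range L\<close> as well as in the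
      kernel of \<open>P\<close>, and these meet only in 0.\<close>
    then have "L (one + g w) = w - P w" by (simp add: inv one_right L_def)
    then obtain x where x: "x \<in> range (ad a)" "w - P w = L (g x)" using rL by (metis imageE rangeI)
    then have "P (L (g x)) = 0" by (metis P.diff PP diff_self)
    then have "w - P w = 0" using inj x L.zero g.zero by metis
    then show "w \<in> range (ad a)" using P_range by (metis eq_iff_diff_eq_0)
  qed

  \<comment> \<open>The inverse function theorem needs a derivative that is continuous as an
    operator; in finite dimension continuity at each fixed argument \<open>h\<close>
    suffices.\<close>
  define F where "F w = Blinfun (\<Phi>' w)" for w
  have F: "blinfun_apply (F w) = \<Phi>' w" if "w \<in> U0" for w
    unfolding F_def by (rule bounded_linear_Blinfun_apply[OF has_derivative_bounded_linear[OF \<Phi>_deriv[OF that]]])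
  have F_cont: "continuous_on U1 F"
  proof (rule continuous_on_subset[OF continuous_on_blinfun_componentwise U1(3)])
    fix h
    have "continuous_on U0 (\<lambda>w. \<Phi>' w h)"
      unfolding \<Phi>'_def by (intro continuous_intros times.continuous_on bg.continuous_on bP.continuous_on u_cont)
    then show "continuous_on U0 (\<lambda>w. blinfun_apply (F w) h)"
      by (rule continuous_on_cong[THEN iffD1, rotated -1]) (auto simp: F)
  qed
  have F0: "id_blinfun o\<^sub>L F 0 = id_blinfun"
    by (rule blinfun_eqI) (simp add: F[OF zero_U0] \<Phi>'0)
  have F_deriv: "(\<Phi> has_derivative blinfun_apply (F w)) (at w)" if "w \<in> U1" for w
    using \<Phi>_deriv F U1(3) that by (metis subsetD)
  obtain V U \<phi> \<phi>' where chart: "open V" "V \<subseteq> U1" "0 \<in> V" "open U" "\<Phi> 0 \<in> U" "homeomorphism V U \<Phi> \<phi>"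
    "\<And>y. y \<in> U \<Longrightarrow> (\<phi> has_derivative (\<phi>' y)) (at y)"
    "\<And>y. y \<in> U \<Longrightarrow> \<phi>' y = inv_into UNIV (blinfun_apply (F (\<phi> y)))"
    "\<And>y. y \<in> U \<Longrightarrow> bij (blinfun_apply (F (\<phi> y)))"
    using inverse_function_theorem[OF U1(1) F_deriv F_cont U1(2) F0] by blast
  have l\<Phi>': "Vector_Spaces.linear (*s) (*s) (\<Phi>' w)" for w
  proof -
    have "Vector_Spaces.linear (*s) (*s) (\<lambda>h. c \<star> (- (d \<star> g h \<star> d)) + (g h \<star> a + (h - P h)) \<star> d)" for c d
      by unfold_locales (simp_all add: g.add g.scale P.add P.scale add_left add_right scale_left
          scale_right times.minus_right times.diff_left times.diff_right algebra_simps
          vec.scale_right_diff_distrib)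
    then show ?thesis by (simp add: \<Phi>'_def[abs_def])
  qed
  have homeo: "\<And>y. y \<in> U \<Longrightarrow> \<phi> y \<in> V" "\<And>w. w \<in> V \<Longrightarrow> \<Phi> w \<in> U" "\<And>w. w \<in> V \<Longrightarrow> \<phi> (\<Phi> w) = w"
      "\<And>y. y \<in> U \<Longrightarrow> \<Phi> (\<phi> y) = y"
    using chart(6) by (auto simp: homeomorphism_def)
  show ?thesis
  proof (rule that[of U V \<phi> \<Phi>])
    show "open U" "open V" "a \<in> U" using chart \<Phi>0 by auto
    show "homeomorphism U V \<phi> \<Phi>" using chart(6) by (rule homeomorphism_symD)
    show "holomorphic_map_on \<Phi> V"
      unfolding holomorphic_map_on_def using \<Phi>_deriv l\<Phi>' chart(2) U1(3) by blast
    \<comment> \<open>The inverse function theorem used here is real; complex linearity of the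
      derivative of \<open>\<phi>\<close> holds because it is the inverse of a complex linear
      bijection.\<close>
    show "holomorphic_map_on \<phi> U"
      unfolding holomorphic_map_on_def
    proof (intro ballI exI conjI)
      fix y assume y: "y \<in> U"
      show "(\<phi> has_derivative \<phi>' y) (at y)" using chart(7) y .
      have F\<phi>: "blinfun_apply (F (\<phi> y)) = \<Phi>' (\<phi> y)"
        using F homeo(1)[OF y] chart(2) U1(3) by blast
      interpret q: Vector_Spaces.linear "(*s)" "(*s)" "\<Phi>' (\<phi> y)" by (rule l\<Phi>')
      have "bij (\<Phi>' (\<phi> y))" using chart(9)[OF y] by (simp add: F\<phi>)
      then have q: "\<Phi>' (\<phi> y) (inv_into UNIV (\<Phi>' (\<phi> y)) z) = z" "inv_into UNIV (\<Phi>' (\<phi> y)) (\<Phi>' (\<phi> y) z) = z" for z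
        by (simp_all add: bij_is_surj surj_f_inv_f bij_is_inj)
      show "Vector_Spaces.linear (*s) (*s) (\<phi>' y)"
        unfolding chart(8)[OF y] F\<phi>
        by unfold_locales (metis q q.add, metis q q.scale)
    qed
    show "\<phi> ` (conj_class a \<inter> U) = V \<inter> range (ad a)"
    proof (intro equalityI subsetI)
      fix w assume "w \<in> \<phi> ` (conj_class a \<inter> U)"
      then obtain y where "y \<in> conj_class a" "y \<in> U" "w = \<phi> y" by blast
      then show "w \<in> V \<inter> range (ad a)"
        using homeo(1,4) in_class[of "\<phi> y"] chart(2) by auto
    next
      fix w assume w: "w \<in> V \<inter> range (ad a)"
      then have "\<Phi> w \<in> conj_class a \<inter> U" "w = \<phi> (\<Phi> w)"
        using homeo(2,3) in_class[of w] chart(2) by auto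
      then show "w \<in> \<phi> ` (conj_class a \<inter> U)" by blast
    qed
  qed
qed

text \<open>At a point \<open>b\<close> the chart built from \<open>ad b\<close> is used: the
  classes of \<open>a\<close> and \<open>b\<close> coincide, and \<open>ad b\<close> has the rank of
  \<open>ad a\<close>.\<close>

theorem complex_submanifold_conj_class:
  "complex_submanifold (conj_class a) (vec.dim (range (ad a)))"
  unfolding complex_submanifold_def
proof
  fix b assume b: "b \<in> conj_class a"
  interpret adb: Vector_Spaces.linear "(*s)" "(*s)" "ad b" by (rule linear_ad)
  obtain U V \<phi> \<psi> where chart: "open U" "b \<in> U" "open V" "homeomorphism U V \<phi> \<psi>"
    "holomorphic_map_on \<phi> U" "holomorphic_map_on \<psi> V"
    "\<phi> ` (conj_class b \<inter> U) = V \<inter> range (ad b)"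
    using conj_class_chart by blast
  have sub: "vec.subspace (range (ad b))" by (rule adb.subspace_image) simp
  show "\<exists>U (V :: (complex ^ 'm) set) \<phi> \<psi> L. open U \<and> b \<in> U \<and> open V \<and> homeomorphism U V \<phi> \<psi> \<and>
        holomorphic_map_on \<phi> U \<and> holomorphic_map_on \<psi> V \<and>
        vec.subspace L \<and> vec.dim L = vec.dim (range (ad a)) \<and> \<phi> ` (conj_class a \<inter> U) = V \<inter> L"
    by (intro exI conjI, rule chart(1), rule chart(2), rule chart(3), rule chart(4), rule chart(5),
        rule chart(6), rule sub, rule dim_range_ad_conj[OF b], rule chart(7)[unfolded conj_class_eq[OF b]])
qed

end

section \<open>The commutant of a Jordan matrix\<close>

text \<open>
  Entries of a Jordan matrix whose rows and columns are labelled by pairs of a block and an offset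
  in that block; \<open>l\<close> gives the eigenvalue of each block.
\<close>

definition jordan_entry :: "('b \<Rightarrow> complex) \<Rightarrow> 'b \<times> nat \<Rightarrow> 'b \<times> nat \<Rightarrow> complex" where
  "jordan_entry l r c =
     (if fst r = fst c then if snd r = snd c then l (fst r) else if Suc (snd r) = snd c then 1 else 0
      else 0)"

text \<open>Every coordinate is either 0 or a copy of the one at its base position, so the fixed
  points of \<open>base\<close> inside \<open>G\<close> are the free coordinates. The map
  \<open>h\<close> copies their values to all positions.\<close>

lemma vec_dim_pattern:
  fixes base :: "'m::finite \<Rightarrow> 'm"
  assumes "\<And>p. G p \<Longrightarrow> G (base p)" "\<And>p. G p \<Longrightarrow> base (base p) = base p"
  shows "vec.dim {x :: complex ^ 'm. \<forall>p. x $ p = (if G p then x $ base p else 0)}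
    = card {p. G p \<and> base p = p}"
proof -
  define F where "F = {p. G p \<and> base p = p}"
  define C where "C = {x :: complex ^ 'm. \<forall>i. i \<notin> F \<longrightarrow> x $ i = 0}"
  define h :: "complex ^ 'm \<Rightarrow> complex ^ 'm" where "h x = (\<chi> p. if G p then x $ base p else 0)" for x
  have lh: "Vector_Spaces.linear (*s) (*s) h"
    by unfold_locales (auto simp: h_def Finite_Cartesian_Product.vec_eq_iff)
  have C: "vec.subspace C" by (auto simp: C_def vec.subspace_def)
  have "inj_on h C"
  proof (rule inj_onI)
    fix x y assume xy: "x \<in> C" "y \<in> C" "h x = h y"
    have "x $ p = y $ p" for p
    proof (cases "p \<in> F")
      case True
      then have "h x $ p = x $ p" "h y $ p = y $ p" by (simp_all add: h_def F_def)
      then show ?thesis using xy(3) by simp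
    qed (use xy in \<open>simp add: C_def\<close>)
    then show "x = y" by (simp add: Finite_Cartesian_Product.vec_eq_iff)
  qed
  then have "vec.dim (h ` C) = vec.dim C"
    by (intro vec.dim_image_eq[OF lh]) (use C vec.span_eq_iff in metis)
  also have "\<dots> = card F" unfolding C_def by (rule dim_substandard_cart)
  also have "h ` C = {x. \<forall>p. x $ p = (if G p then x $ base p else 0)}"
  proof (intro equalityI subsetI)
    fix x assume "x \<in> h ` C"
    then show "x \<in> {x. \<forall>p. x $ p = (if G p then x $ base p else 0)}"
      using assms by (auto simp: h_def)
  next
    fix x :: "complex ^ 'm" assume x: "x \<in> {x. \<forall>p. x $ p = (if G p then x $ base p else 0)}"
    define y where "y = (\<chi> p. if p \<in> F then x $ p else 0)"
    have "base p \<in> F" if "G p" for p using assms that by (simp add: F_def)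
    then have "h y $ p = x $ p" for p
      using x by (cases "G p") (simp_all add: h_def y_def)
    then have "x = h y" by (simp add: Finite_Cartesian_Product.vec_eq_iff)
    moreover have "y \<in> C" by (simp add: C_def y_def)
    ultimately show "x \<in> h ` C" by blast
  qed
  finally show ?thesis by (simp add: F_def)
qed

text \<open>
  The blocks of the solutions of \<open>J Y = Y J\<close> are upper triangular Toeplitz matrices, and they vanish
  between blocks with different eigenvalues.
\<close>

lemma jordan_commutant_iff:
  fixes Y :: "'b \<Rightarrow> nat \<Rightarrow> 'b \<Rightarrow> nat \<Rightarrow> complex"
  shows "(\<forall>d\<in>B. \<forall>i<s d. \<forall>b\<in>B. \<forall>j<s b.
      l b * Y d i b j + (if j > 0 then Y d i b (j - 1) else 0)
        = l d * Y d i b j + (if Suc i < s d then Y d (Suc i) b j else 0)) \<longleftrightarrow>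
    (\<forall>d\<in>B. \<forall>i<s d. \<forall>b\<in>B. \<forall>j<s b.
      Y d i b j = (if l b = l d \<and> i \<le> j \<and> s b \<le> j - i + s d then Y d 0 b (j - i) else 0))"
    (is "?E \<longleftrightarrow> ?T")
proof
  assume E: ?E
  have eq: "l b * Y d i b j + (if j > 0 then Y d i b (j - 1) else 0)
        = l d * Y d i b j + (if Suc i < s d then Y d (Suc i) b j else 0)"
    if "d \<in> B" "i < s d" "b \<in> B" "j < s b" for d i b j
    using E that by blast
  show ?T
  proof (intro ballI allI impI)
    fix d i b j assume db: "d \<in> B" "i < s d" "b \<in> B" "j < s b"
    show "Y d i b j = (if l b = l d \<and> i \<le> j \<and> s b \<le> j - i + s d then Y d 0 b (j - i) else 0)"
    proof (cases "l b = l d")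
      case False
      \<comment> \<open>The equation at \<open>(i, j)\<close> expresses
        \<open>(l b - l d) * Y d i b j\<close> through the entries to the left and below, both of
        smaller measure.\<close>
      have "i < s d \<Longrightarrow> j < s b \<Longrightarrow> Y d i b j = 0" for i j
      proof (induction "j + (s d - i)" arbitrary: i j rule: less_induct)
        case less
        have "(l b - l d) * Y d i b j = 0"
          using eq[OF db(1) less.prems(1) db(3) less.prems(2)] less.hyps[of "j - 1" i] less.hyps[of j "Suc i"]
            less.prems by (auto simp: algebra_simps split: if_splits)
        then show ?case using False by simp
      qed
      then show ?thesis using False db by simp
    next
      case True
      \<comment> \<open>For equal eigenvalues the diagonal terms cancel, and what remains shifts
        entries down a diagonal. The last row has nothing below it, which gives
        \<open>last\<close>.\<close>
      have step: "Y d (Suc i) b j = (if j > 0 then Y d i b (j - 1) else 0)" if "Suc i < s d" "j < s b" for i j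
        using eq[OF db(1) _ db(3) that(2), of i] that True by simp
      have last: "Y d (s d - 1) b (j - 1) = 0" if "j > 0" "j < s b" for j
        using eq[OF db(1) _ db(3) that(2), of "s d - 1"] that True db(2) by simp
      have toep: "i < s d \<Longrightarrow> j < s b \<Longrightarrow> Y d i b j = (if i \<le> j then Y d 0 b (j - i) else 0)" for i j
      proof (induction i arbitrary: j)
        case (Suc i)
        then show ?case using step[of i j] Suc.IH[of "j - 1"] by auto
      qed simp
      \<comment> \<open>The diagonal starting at \<open>(0, t)\<close> leaves through the last row
        at column \<open>t + s d - 1\<close>, which is not the last column; the entry there vanishes
        by \<open>last\<close>.\<close>
      have "Y d 0 b t = 0" if "t + s d < s b" for t
      proof -
        have "Y d (s d - 1) b (t + s d - 1) = Y d 0 b (t + s d - 1 - (s d - 1))"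
          using toep[of "s d - 1" "t + s d - 1"] that db(2) by simp
        moreover have "t + s d - 1 - (s d - 1) = t" using db(2) by simp
        moreover have "Y d (s d - 1) b (t + s d - 1) = 0"
          using last[of "t + s d"] that db(2) by simp
        ultimately show ?thesis by metis
      qed
      then show ?thesis using toep[of i j] db True by auto
    qed
  qed
next
  assume T: ?T
  have eq: "Y d i b j = (if l b = l d \<and> i \<le> j \<and> s b \<le> j - i + s d then Y d 0 b (j - i) else 0)"
    if "d \<in> B" "i < s d" "b \<in> B" "j < s b" for d i b j
    using T that by blast
  show ?E
  proof (intro ballI allI impI)
    fix d i b j assume db: "d \<in> B" "i < s d" "b \<in> B" "j < s b"
    show "l b * Y d i b j + (if j > 0 then Y d i b (j - 1) else 0)
        = l d * Y d i b j + (if Suc i < s d then Y d (Suc i) b j else 0)"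
    proof (cases "l b = l d")
      case False
      then show ?thesis
        using eq[OF db] eq[OF db(1,2,3), of "j - 1"] eq[OF db(1) _ db(3,4), of "Suc i"] db by auto
    next
      case True
      have "(if j > 0 then Y d i b (j - 1) else 0) = (if Suc i < s d then Y d (Suc i) b j else 0)"
      proof (cases "j > 0")
        case j: True
        have 1: "Y d i b (j - 1) = (if i \<le> j - 1 \<and> s b \<le> j - 1 - i + s d then Y d 0 b (j - 1 - i) else 0)"
          using eq[OF db(1,2,3), of "j - 1"] True db(4) by simp
        show ?thesis
        proof (cases "Suc i < s d")
          case i: True
          have "Y d (Suc i) b j = (if Suc i \<le> j \<and> s b \<le> j - Suc i + s d then Y d 0 b (j - Suc i) else 0)"
            using eq[OF db(1) i db(3,4)] True by simp
          moreover have "j - Suc i = j - 1 - i" "Suc i \<le> j \<longleftrightarrow> i \<le> j - 1" using j by auto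
          ultimately show ?thesis using 1 i j by presburger
        next
          case False
          \<comment> \<open>Here \<open>i = s d - 1\<close>, so if \<open>i \<le> j - 1\<close> then
            \<open>j - 1 - i + s d\<close> equals \<open>j\<close>, which is below
            \<open>s b\<close>.\<close>
          then have "\<not> (i \<le> j - 1 \<and> s b \<le> j - 1 - i + s d)" using db j by auto
          then show ?thesis using 1 False j by (metis (full_types))
        qed
      next
        case False
        then show ?thesis using eq[OF db(1) _ db(3,4), of "Suc i"] by auto
      qed
      then show ?thesis using True by simp
    qed
  qed
qed

text \<open>In labels the condition is the system of \<open>jordan_commutant_iff\<close>, which has
  the form treated by \<open>vec_dim_pattern\<close>. The free coordinates of a block pair are the
  admissible entries in its first row.\<close>

lemma dim_jordan_commutant:
  fixes \<iota> :: "'n::finite \<Rightarrow> 'b \<times> nat"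
  assumes bij: "bij_betw \<iota> UNIV (SIGMA b:B. {..<s b})" and B: "finite B"
  shows "vec.dim {X :: complex ^ ('n \<times> 'n). \<forall>r c.
        (\<Sum>k\<in>UNIV. X $ (r, k) * jordan_entry l (\<iota> k) (\<iota> c)) = (\<Sum>k\<in>UNIV. jordan_entry l (\<iota> r) (\<iota> k) * X $ (k, c))}
    = (\<Sum>d\<in>B. \<Sum>b\<in>{b\<in>B. l b = l d}. min (s d) (s b))" (is "vec.dim ?K = _")
proof -
  define \<kappa> where "\<kappa> b j = inv_into UNIV \<iota> (b, j)" for b j
  have \<iota>\<kappa>: "\<iota> (\<kappa> b j) = (b, j)" if "b \<in> B" "j < s b" for b j
    unfolding \<kappa>_def by (rule f_inv_into_f) (use bij that in \<open>auto simp: bij_betw_def\<close>)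
  have \<kappa>\<iota>: "\<kappa> (fst (\<iota> r)) (snd (\<iota> r)) = r" for r
    unfolding \<kappa>_def using bij by (simp add: bij_betw_def)
  have \<iota>_in: "fst (\<iota> r) \<in> B" "snd (\<iota> r) < s (fst (\<iota> r))" for r
  proof -
    have "\<iota> r \<in> (SIGMA b:B. {..<s b})" using bij_betwE[OF bij] by blast
    then show "fst (\<iota> r) \<in> B" "snd (\<iota> r) < s (fst (\<iota> r))" by auto
  qed
  have \<kappa>_eq: "r = \<kappa> b j \<longleftrightarrow> \<iota> r = (b, j)" if "b \<in> B" "j < s b" for r b j
    using \<iota>\<kappa>[OF that] \<kappa>\<iota>[of r] by auto
  have col: "(\<Sum>k\<in>UNIV. f k * jordan_entry l (\<iota> k) (b, j))
      = l b * f (\<kappa> b j) + (if j > 0 then f (\<kappa> b (j - 1)) else 0)"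
    if b: "b \<in> B" "j < s b" for f :: "'n \<Rightarrow> complex" and b j
  proof -
    \<comment> \<open>For \<open>j = 0\<close> truncated subtraction makes \<open>j - 1\<close>
      equal to \<open>j\<close>; the inner guard cancels the spurious term.\<close>
    have "f k * jordan_entry l (\<iota> k) (b, j) = (if k = \<kappa> b j then l b * f k else 0)
        + (if k = \<kappa> b (j - 1) then if j > 0 then f k else 0 else 0)" for k
      using b \<kappa>_eq[of b j k] \<kappa>_eq[of b "j - 1" k] by (auto simp: jordan_entry_def prod_eq_iff)
    then show ?thesis by (simp add: sum.distrib)
  qed
  have row: "(\<Sum>k\<in>UNIV. jordan_entry l (d, i) (\<iota> k) * f k)
      = l d * f (\<kappa> d i) + (if Suc i < s d then f (\<kappa> d (Suc i)) else 0)"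
    if d: "d \<in> B" "i < s d" for f :: "'n \<Rightarrow> complex" and d i
  proof -
    have "jordan_entry l (d, i) (\<iota> k) * f k = (if k = \<kappa> d i then l d * f k else 0)
        + (if Suc i < s d then if k = \<kappa> d (Suc i) then f k else 0 else 0)" for k
      using d \<kappa>_eq[of d i k] \<kappa>_eq[of d "Suc i" k] \<iota>_in[of k]
      by (auto simp: jordan_entry_def prod_eq_iff)
    then show ?thesis by (simp add: sum.distrib)
  qed
  have all_iff: "(\<forall>r c. Q (\<iota> r) (\<iota> c)) \<longleftrightarrow> (\<forall>d\<in>B. \<forall>i<s d. \<forall>b\<in>B. \<forall>j<s b. Q (d, i) (b, j))"
    for Q
    using \<iota>\<kappa> \<iota>_in by (metis prod.collapse)
  \<comment> \<open>\<open>G\<close> selects the positions on diagonals that may be nonzero, and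
    \<open>base\<close> moves along such a diagonal back to row offset 0.\<close>
  define G where "G p = (case (\<iota> (fst p), \<iota> (snd p)) of ((d, i), (b, j)) \<Rightarrow>
      l b = l d \<and> i \<le> j \<and> s b \<le> j - i + s d)" for p :: "'n \<times> 'n"
  define base where "base p = (case (\<iota> (fst p), \<iota> (snd p)) of ((d, i), (b, j)) \<Rightarrow>
      (\<kappa> d 0, \<kappa> b (j - i)))" for p :: "'n \<times> 'n"
  have \<iota>\<kappa>': "\<iota> (\<kappa> (fst (\<iota> r)) 0) = (fst (\<iota> r), 0)"
    "\<iota> (\<kappa> (fst (\<iota> r)) (snd (\<iota> r) - k)) = (fst (\<iota> r), snd (\<iota> r) - k)" for r k
    using \<iota>_in[of r] by (auto intro!: \<iota>\<kappa>)
  have K: "?K = {X. \<forall>p. X $ p = (if G p then X $ base p else 0)}"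
  proof (intro Collect_cong)
    fix X :: "complex ^ ('n \<times> 'n)"
    define Y where "Y d i b j = X $ (\<kappa> d i, \<kappa> b j)" for d i b j
    have X: "X $ (r, c) = Y (fst (\<iota> r)) (snd (\<iota> r)) (fst (\<iota> c)) (snd (\<iota> c))" for r c
      by (simp add: Y_def \<kappa>\<iota>)
    have "(\<forall>r c. (\<Sum>k\<in>UNIV. X $ (r, k) * jordan_entry l (\<iota> k) (\<iota> c))
          = (\<Sum>k\<in>UNIV. jordan_entry l (\<iota> r) (\<iota> k) * X $ (k, c)))
        \<longleftrightarrow> (\<forall>r c. (\<Sum>k\<in>UNIV. X $ (\<kappa> (fst (\<iota> r)) (snd (\<iota> r)), k) * jordan_entry l (\<iota> k) (\<iota> c))
          = (\<Sum>k\<in>UNIV. jordan_entry l (\<iota> r) (\<iota> k) * X $ (k, \<kappa> (fst (\<iota> c)) (snd (\<iota> c)))))"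
      by (simp add: \<kappa>\<iota>)
    also have "\<dots> \<longleftrightarrow> (\<forall>d\<in>B. \<forall>i<s d. \<forall>b\<in>B. \<forall>j<s b.
        (\<Sum>k\<in>UNIV. X $ (\<kappa> d i, k) * jordan_entry l (\<iota> k) (b, j))
          = (\<Sum>k\<in>UNIV. jordan_entry l (d, i) (\<iota> k) * X $ (k, \<kappa> b j)))"
      by (subst all_iff) simp
    also have "\<dots> \<longleftrightarrow> (\<forall>d\<in>B. \<forall>i<s d. \<forall>b\<in>B. \<forall>j<s b.
      l b * Y d i b j + (if j > 0 then Y d i b (j - 1) else 0)
        = l d * Y d i b j + (if Suc i < s d then Y d (Suc i) b j else 0))"
      by (intro ball_cong all_cong refl) (simp add: row col Y_def)
    also have "\<dots> \<longleftrightarrow> (\<forall>d\<in>B. \<forall>i<s d. \<forall>b\<in>B. \<forall>j<s b.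
        Y d i b j = (if l b = l d \<and> i \<le> j \<and> s b \<le> j - i + s d then Y d 0 b (j - i) else 0))"
      by (rule jordan_commutant_iff)
    also have "\<dots> \<longleftrightarrow> (\<forall>p. X $ p = (if G p then X $ base p else 0))"
      using all_iff[of "\<lambda>r c. Y (fst r) (snd r) (fst c) (snd c) =
          (if l (fst c) = l (fst r) \<and> snd r \<le> snd c \<and> s (fst c) \<le> snd c - snd r + s (fst r)
           then Y (fst r) 0 (fst c) (snd c - snd r) else 0)", symmetric]
      by (simp only: fst_conv snd_conv split_paired_All G_def base_def Y_def case_prod_unfold \<kappa>\<iota>)
    finally show "(\<forall>r c. (\<Sum>k\<in>UNIV. X $ (r, k) * jordan_entry l (\<iota> k) (\<iota> c))
          = (\<Sum>k\<in>UNIV. jordan_entry l (\<iota> r) (\<iota> k) * X $ (k, c)))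
        \<longleftrightarrow> (\<forall>p. X $ p = (if G p then X $ base p else 0))" .
  qed
  have "vec.dim ?K = card {p. G p \<and> base p = p}"
    unfolding K by (rule vec_dim_pattern) (auto simp: G_def base_def case_prod_unfold \<iota>\<kappa>')
  \<comment> \<open>A fixed position has row offset 0, so it is recorded by its row block together
    with the full label of its column.\<close>
  also have "\<dots> = card (SIGMA d:B. SIGMA b:{b\<in>B. l b = l d}. {t. t < s b \<and> s b \<le> t + s d})"
  proof (rule bij_betw_same_card[of "\<lambda>p. (fst (\<iota> (fst p)), \<iota> (snd p))"])
    show "bij_betw (\<lambda>p. (fst (\<iota> (fst p)), \<iota> (snd p))) {p. G p \<and> base p = p}
      (SIGMA d:B. SIGMA b:{b\<in>B. l b = l d}. {t. t < s b \<and> s b \<le> t + s d})"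
    proof (rule bij_betw_byWitness[where f' = "\<lambda>(d, b, t). (\<kappa> d 0, \<kappa> b t)"])
      show "\<forall>p\<in>{p. G p \<and> base p = p}.
          (case (fst (\<iota> (fst p)), \<iota> (snd p)) of (d, b, t) \<Rightarrow> (\<kappa> d 0, \<kappa> b t)) = p"
        by (auto simp: base_def case_prod_unfold \<kappa>\<iota>)
      have pos: "0 < s d" if "t < s b" "s b \<le> t + s d" for d b and t :: nat using that by auto
      show "\<forall>x\<in>SIGMA d:B. SIGMA b:{b\<in>B. l b = l d}. {t. t < s b \<and> s b \<le> t + s d}.
          (fst (\<iota> (fst (case x of (d, b, t) \<Rightarrow> (\<kappa> d 0, \<kappa> b t)))),
           \<iota> (snd (case x of (d, b, t) \<Rightarrow> (\<kappa> d 0, \<kappa> b t)))) = x"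
        using pos by (auto simp: \<iota>\<kappa>)
      show "(\<lambda>(d, b, t). (\<kappa> d 0, \<kappa> b t)) ` (SIGMA d:B. SIGMA b:{b\<in>B. l b = l d}. {t. t < s b \<and> s b \<le> t + s d})
          \<subseteq> {p. G p \<and> base p = p}"
        using pos by (auto simp: G_def base_def \<iota>\<kappa>)
      show "(\<lambda>p. (fst (\<iota> (fst p)), \<iota> (snd p))) ` {p. G p \<and> base p = p}
          \<subseteq> (SIGMA d:B. SIGMA b:{b\<in>B. l b = l d}. {t. t < s b \<and> s b \<le> t + s d})"
      proof (clarsimp simp: mem_Sigma_iff)
        fix r c assume G: "G (r, c)" and "base (r, c) = (r, c)"
        then have "\<kappa> (fst (\<iota> r)) 0 = r" by (simp add: base_def case_prod_unfold)
        then have "snd (\<iota> r) = 0" using \<iota>\<kappa>'(1)[of r] by (metis snd_conv)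
        then show "fst (\<iota> r) \<in> B \<and> \<iota> c \<in> (SIGMA b:{b\<in>B. l b = l (fst (\<iota> r))}. {t. t < s b \<and> s b \<le> t + s (fst (\<iota> r))})"
          using G \<iota>_in[of r] \<iota>_in[of c] by (cases "\<iota> c") (auto simp: G_def case_prod_unfold)
      qed
    qed
  qed
  also have "\<dots> = (\<Sum>d\<in>B. \<Sum>b\<in>{b\<in>B. l b = l d}. min (s d) (s b))"
  proof -
    have "card {t. t < s b \<and> s b \<le> t + s d} = min (s d) (s b)" for b d
    proof -
      have "{t. t < s b \<and> s b \<le> t + s d} = {s b - s d..<s b}" by auto
      then show ?thesis by simp
    qed
    then show ?thesis using B by (simp add: card_SigmaI)
  qed
  finally show ?thesis .
qed

section \<open>Determinantal divisors of a Jordan matrix\<close>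

text \<open>The Leibniz formula for a minor, with permutations of positions transported by
  \<open>pick\<close> to bijections from \<open>I\<close> to \<open>K\<close>. The last two
  conclusions make this transport injective and surjective, which allows a single term to be
  isolated.\<close>

lemma det_submatrix_expansion:
  fixes A :: "'a::comm_ring_1 mat"
  assumes I: "I \<subseteq> {..<dim_row A}" "K \<subseteq> {..<dim_col A}" "card I = card K"
  obtains \<sigma> :: "(nat \<Rightarrow> nat) \<Rightarrow> nat \<Rightarrow> nat" where
    "Determinant.det (submatrix A I K)
      = (\<Sum>p\<in>{p. p permutes {0..<card I}}. signof p * (\<Prod>r\<in>I. A $$ (r, \<sigma> p r)))"
    "\<And>p. p permutes {0..<card I} \<Longrightarrow> bij_betw (\<sigma> p) I K"
    "\<And>p q. p permutes {0..<card I} \<Longrightarrow> q permutes {0..<card I} \<Longrightarrow> (\<And>r. r \<in> I \<Longrightarrow> \<sigma> p r = \<sigma> q r) \<Longrightarrow> p = q"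
    "\<And>\<tau>. bij_betw \<tau> I K \<Longrightarrow> \<exists>p. p permutes {0..<card I} \<and> (\<forall>r\<in>I. \<sigma> p r = \<tau> r)"
proof -
  define m where "m = card I"
  have fin: "finite I" "finite K" using I finite_subset by blast+
  have pick_bij: "bij_betw (pick S) {0..<card S} S" if "finite S" for S :: "nat set"
  proof (rule bij_betw_byWitness[where f' = "\<lambda>i. card {a\<in>S. a < i}"])
    show "\<forall>i\<in>{0..<card S}. card {a \<in> S. a < pick S i} = i" using card_pick by simp
    show "\<forall>i\<in>S. pick S (card {a \<in> S. a < i}) = i" using pick_card_in_set by simp
    show "pick S ` {0..<card S} \<subseteq> S" using pick_in_set by auto
    have "card {a\<in>S. a < i} < card S" if "i \<in> S" for i
      using that \<open>finite S\<close> by (intro psubset_card_mono) auto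
    then show "(\<lambda>i. card {a \<in> S. a < i}) ` S \<subseteq> {0..<card S}" by auto
  qed
  have bI: "bij_betw (pick I) {0..<m} I" using pick_bij[OF fin(1)] by (simp add: m_def)
  have bK: "bij_betw (pick K) {0..<m} K" using pick_bij[OF fin(2)] by (simp add: m_def I(3))
  define iI where "iI = the_inv_into {0..<m} (pick I)"
  have iI: "bij_betw iI I {0..<m}" unfolding iI_def by (rule bij_betw_the_inv_into[OF bI])
  have iI1: "iI (pick I i) = i" if "i < m" for i
    unfolding iI_def by (rule the_inv_into_f_f) (use bI that in \<open>auto simp: bij_betw_def\<close>)
  have iI2: "pick I (iI r) = r" if "r \<in> I" for r
    unfolding iI_def by (rule f_the_inv_into_f_bij_betw[OF bI]) (use that in auto)
  define \<sigma> where "\<sigma> p r = pick K (p (iI r))" for p r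
  have sub: "{i. i < dim_row A \<and> i \<in> I} = I" "{i. i < dim_col A \<and> i \<in> K} = K" using I by auto
  have bij: "bij_betw (\<sigma> p) I K" if "p permutes {0..<m}" for p
    using bij_betw_trans[OF bij_betw_trans[OF iI permutes_imp_bij[OF that]] bK]
    by (simp add: \<sigma>_def[abs_def] o_def)
  show ?thesis
  proof (rule that[of \<sigma>, folded m_def])
    have "submatrix A I K \<in> carrier_mat m m"
      by (rule carrier_matI) (simp_all add: dim_submatrix sub m_def I)
    then have "Determinant.det (submatrix A I K)
        = (\<Sum>p\<in>{p. p permutes {0..<m}}. signof p * (\<Prod>i=0..<m. submatrix A I K $$ (i, p i)))"
      by (rule det_def')
    also have "\<dots> = (\<Sum>p\<in>{p. p permutes {0..<m}}. signof p * (\<Prod>r\<in>I. A $$ (r, \<sigma> p r)))"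
    proof (intro sum.cong refl arg_cong2[where f = "(*)"])
      fix p assume p: "p \<in> {p. p permutes {0..<m}}"
      then have pm: "p i < m" if "i < m" for i using that permutes_in_image[of p "{0..<m}" i] by simp
      have "(\<Prod>i=0..<m. submatrix A I K $$ (i, p i)) = (\<Prod>i=0..<m. A $$ (pick I i, \<sigma> p (pick I i)))"
        by (intro prod.cong refl, subst submatrix_index)
          (simp_all add: sub m_def[symmetric] I(3)[symmetric] \<sigma>_def iI1 pm)
      also have "\<dots> = (\<Prod>r\<in>I. A $$ (r, \<sigma> p r))"
        by (rule prod.reindex_bij_betw[OF bI])
      finally show "(\<Prod>i=0..<m. submatrix A I K $$ (i, p i)) = (\<Prod>r\<in>I. A $$ (r, \<sigma> p r))" .
    qed
    finally show "Determinant.det (submatrix A I K)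
        = (\<Sum>p\<in>{p. p permutes {0..<m}}. signof p * (\<Prod>r\<in>I. A $$ (r, \<sigma> p r)))" .
    show "bij_betw (\<sigma> p) I K" if "p permutes {0..<m}" for p by (rule bij[OF that])
    show "p = q" if p: "p permutes {0..<m}" and q: "q permutes {0..<m}"
      and eq: "\<And>r. r \<in> I \<Longrightarrow> \<sigma> p r = \<sigma> q r" for p q
    proof
      fix i
      show "p i = q i"
      proof (cases "i < m")
        case True
        then have "pick I i \<in> I" using bI by (auto simp: bij_betw_def)
        from eq[OF this] have "pick K (p i) = pick K (q i)" using True by (simp add: \<sigma>_def iI1)
        moreover have "p i < m" "q i < m"
          using True permutes_in_image[OF p, of i] permutes_in_image[OF q, of i] by simp_all
        ultimately show ?thesis using bK by (auto simp: bij_betw_def inj_on_def)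
      qed (use p q in \<open>simp add: permutes_def\<close>)
    qed
    show "\<exists>p. p permutes {0..<m} \<and> (\<forall>r\<in>I. \<sigma> p r = \<tau> r)" if \<tau>: "bij_betw \<tau> I K" for \<tau>
    proof -
      define q where "q = the_inv_into {0..<m} (pick K) \<circ> \<tau> \<circ> pick I"
      have q: "bij_betw q {0..<m} {0..<m}"
        unfolding q_def by (intro bij_betw_trans[OF bI] bij_betw_trans[OF \<tau>] bij_betw_the_inv_into[OF bK])
      define p where "p i = (if i \<in> {0..<m} then q i else i)" for i
      have "bij_betw p {0..<m} {0..<m}" using q by (rule bij_betw_cong[THEN iffD1, rotated]) (simp add: p_def)
      then have "p permutes {0..<m}" by (rule bij_imp_permutes) (simp add: p_def)
      moreover have "\<sigma> p r = \<tau> r" if r: "r \<in> I" for r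
      proof -
        have "iI r \<in> {0..<m}" using iI r by (auto simp: bij_betw_def)
        then have "\<sigma> p r = pick K (the_inv_into {0..<m} (pick K) (\<tau> r))"
          by (simp add: \<sigma>_def p_def q_def iI2 r)
        also have "\<dots> = \<tau> r"
          by (rule f_the_inv_into_f_bij_betw[OF bK]) (use \<tau> r in \<open>auto simp: bij_betw_def\<close>)
        finally show ?thesis .
      qed
      ultimately show ?thesis by blast
    qed
  qed
qed

lemma dvd_det_submatrix:
  fixes A :: "'a::comm_ring_1 mat"
  assumes "I \<subseteq> {..<dim_row A}" "K \<subseteq> {..<dim_col A}" "card I = card K"
    and dvd: "\<And>\<sigma>. bij_betw \<sigma> I K \<Longrightarrow> q dvd (\<Prod>r\<in>I. A $$ (r, \<sigma> r))"
  shows "q dvd Determinant.det (submatrix A I K)"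
proof (rule det_submatrix_expansion[OF assms(1-3)])
  fix \<sigma> :: "(nat \<Rightarrow> nat) \<Rightarrow> nat \<Rightarrow> nat"
  assume det: "Determinant.det (submatrix A I K)
      = (\<Sum>p\<in>{p. p permutes {0..<card I}}. signof p * (\<Prod>r\<in>I. A $$ (r, \<sigma> p r)))"
    and \<sigma>: "\<And>p. p permutes {0..<card I} \<Longrightarrow> bij_betw (\<sigma> p) I K"
  show ?thesis unfolding det by (rule dvd_sum, rule dvd_mult, rule dvd, rule \<sigma>) simp
qed

text \<open>Any other term contains a zero entry, so the minor is plus or minus the product along
  \<open>\<tau>\<close>. Divisibility avoids tracking the sign.\<close>

lemma det_submatrix_unique_dvd:
  fixes A :: "'a::idom mat"
  assumes "I \<subseteq> {..<dim_row A}" "K \<subseteq> {..<dim_col A}" "card I = card K"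
    and \<tau>: "bij_betw \<tau> I K"
    and uniq: "\<And>\<sigma> r. bij_betw \<sigma> I K \<Longrightarrow> (\<And>r. r \<in> I \<Longrightarrow> A $$ (r, \<sigma> r) \<noteq> 0) \<Longrightarrow> r \<in> I \<Longrightarrow> \<sigma> r = \<tau> r"
  shows "Determinant.det (submatrix A I K) dvd (\<Prod>r\<in>I. A $$ (r, \<tau> r))"
proof -
  obtain \<sigma> :: "(nat \<Rightarrow> nat) \<Rightarrow> nat \<Rightarrow> nat" where \<sigma>:
    "Determinant.det (submatrix A I K)
      = (\<Sum>p\<in>{p. p permutes {0..<card I}}. signof p * (\<Prod>r\<in>I. A $$ (r, \<sigma> p r)))"
    "\<And>p. p permutes {0..<card I} \<Longrightarrow> bij_betw (\<sigma> p) I K"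
    "\<And>p q. p permutes {0..<card I} \<Longrightarrow> q permutes {0..<card I} \<Longrightarrow> (\<And>r. r \<in> I \<Longrightarrow> \<sigma> p r = \<sigma> q r) \<Longrightarrow> p = q"
    "\<And>\<tau>. bij_betw \<tau> I K \<Longrightarrow> \<exists>p. p permutes {0..<card I} \<and> (\<forall>r\<in>I. \<sigma> p r = \<tau> r)"
    using det_submatrix_expansion[OF assms(1-3)] by blast
  obtain p where p: "p permutes {0..<card I}" "\<forall>r\<in>I. \<sigma> p r = \<tau> r" using \<sigma>(4)[OF \<tau>] by blast
  have finI: "finite I" using assms(1) finite_subset by blast
  have zero: "(\<Prod>r\<in>I. A $$ (r, \<sigma> q r)) = 0" if q: "q permutes {0..<card I}" "q \<noteq> p" for q
  proof (rule ccontr)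
    assume "(\<Prod>r\<in>I. A $$ (r, \<sigma> q r)) \<noteq> 0"
    then have "A $$ (r, \<sigma> q r) \<noteq> 0" if "r \<in> I" for r using that finI by auto
    then have "\<sigma> q r = \<sigma> p r" if "r \<in> I" for r using uniq[OF \<sigma>(2)[OF q(1)]] p(2) that by auto
    then show False using \<sigma>(3)[OF q(1) p(1)] q(2) by blast
  qed
  have "Determinant.det (submatrix A I K) = (\<Sum>q\<in>{p}. signof q * (\<Prod>r\<in>I. A $$ (r, \<sigma> q r)))"
    unfolding \<sigma>(1)
    by (rule sum.mono_neutral_right) (use p(1) zero in \<open>auto simp: finite_permutations\<close>)
  also have "\<dots> = signof p * (\<Prod>r\<in>I. A $$ (r, \<tau> r))" using p(2) by simp
  finally show ?thesis by (auto simp: sign_def)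
qed

section \<open>Multiplicities of roots\<close>

lemma order_prod:
  fixes f :: "'i \<Rightarrow> 'a::idom poly"
  assumes "finite S" "\<And>i. i \<in> S \<Longrightarrow> f i \<noteq> 0"
  shows "Polynomial.order c (\<Prod>i\<in>S. f i) = (\<Sum>i\<in>S. Polynomial.order c (f i))"
  using assms by (induction S rule: finite_induct) (auto simp: order_mult)

text \<open>A root of the cofactor would have larger multiplicity in \<open>q\<close> than in
  \<open>p\<close>; without roots the cofactor is constant over the complex numbers.\<close>

lemma degree_eq_of_dvd_order_le:
  fixes p q :: "complex poly"
  assumes "p dvd q" "q \<noteq> 0" "\<And>c. Polynomial.order c q \<le> Polynomial.order c p"
  obtains u where "q = p * u" "u dvd 1" "degree q = degree p"
proof -
  obtain u where u: "q = p * u" using assms(1) by (auto elim: dvdE)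
  have nz: "p \<noteq> 0" "u \<noteq> 0" using assms(2) u by auto
  have "poly u c \<noteq> 0" for c
    using assms(3)[of c] nz u by (simp add: order_mult order_root)
  then have "constant (poly u)" using fundamental_theorem_of_algebra by blast
  then have "degree u = 0" by (simp add: constant_degree)
  then have "u dvd 1" using nz(2) by (simp add: is_unit_iff_degree)
  with that u \<open>degree u = 0\<close> nz show ?thesis by (simp add: degree_mult_eq)
qed

text \<open>Rows and columns are addressed by block and offset through the bijection
  \<open>\<iota>\<close>, so blocks can later be indexed by pairs of an eigenvalue number and a
  block number.\<close>

locale jordan_labels =
  fixes n :: nat and B :: "'b set" and s :: "'b \<Rightarrow> nat" and l :: "'b \<Rightarrow> complex"
    and \<iota> :: "nat \<Rightarrow> 'b \<times> nat" and J :: "complex mat"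
  assumes fin: "finite B" and pos: "\<And>b. b \<in> B \<Longrightarrow> s b \<ge> 1"
    and bij: "bij_betw \<iota> {..<n} (SIGMA b:B. {..<s b})"
    and J: "J \<in> carrier_mat n n"
    and J_entry: "\<And>r c. r < n \<Longrightarrow> c < n \<Longrightarrow> J $$ (r, c) = jordan_entry l (\<iota> r) (\<iota> c)"
begin

abbreviation "blk r \<equiv> fst (\<iota> r)"
abbreviation "off r \<equiv> snd (\<iota> r)"

definition index :: "'b \<Rightarrow> nat \<Rightarrow> nat" where
  "index b i = inv_into {..<n} \<iota> (b, i)"

lemma blk_off: assumes "r < n" shows "blk r \<in> B" "off r < s (blk r)"
proof -
  have "\<iota> r \<in> (SIGMA b:B. {..<s b})" using bij_betwE[OF bij] assms by blast
  then show "blk r \<in> B" "off r < s (blk r)" by auto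
qed

lemma index:
  assumes "b \<in> B" "i < s b"
  shows "index b i < n" "\<iota> (index b i) = (b, i)"
proof -
  have "(b, i) \<in> \<iota> ` {..<n}" using bij assms by (auto simp: bij_betw_def)
  then show "index b i < n" "\<iota> (index b i) = (b, i)"
    unfolding index_def using inv_into_into[of _ \<iota> "{..<n}"] f_inv_into_f[of _ \<iota> "{..<n}"] by auto
qed

lemma \<iota>_eqD: "r < n \<Longrightarrow> c < n \<Longrightarrow> blk r = blk c \<Longrightarrow> off r = off c \<Longrightarrow> r = c"
  using bij by (auto simp: bij_betw_def inj_on_def prod_eq_iff)

lemma index_eqI: "r < n \<Longrightarrow> blk r = b \<Longrightarrow> off r = i \<Longrightarrow> r = index b i"
  unfolding index_def using bij by (auto simp: bij_betw_def)

lemma card_blk: "b \<in> B \<Longrightarrow> card {r. r < n \<and> blk r = b} = s b"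
proof -
  assume b: "b \<in> B"
  have "bij_betw off {r. r < n \<and> blk r = b} {..<s b}"
  proof (rule bij_betw_byWitness[where f' = "index b"])
    show "\<forall>r\<in>{r. r < n \<and> blk r = b}. index b (off r) = r"
      using index_eqI by auto
    show "\<forall>i\<in>{..<s b}. off (index b i) = i" using index[OF b] by simp
    show "off ` {r. r < n \<and> blk r = b} \<subseteq> {..<s b}" using blk_off(2) by auto
    show "index b ` {..<s b} \<subseteq> {r. r < n \<and> blk r = b}" using index[OF b] by auto
  qed
  then show ?thesis by (simp add: bij_betw_same_card)
qed

lemma char_matrix_entry:
  assumes "r < n" "c < n"
  shows "char_poly_matrix J $$ (r, c) =
    (if r = c then [:- l (blk r), 1:] else if blk r = blk c \<and> off c = Suc (off r) then - 1 else 0)"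
proof -
  have "char_poly_matrix J $$ (r, c) = (if r = c then [:0, 1:] else 0) + [: - J $$ (r, c) :]"
    using J assms by (simp add: char_poly_matrix_def)
  then show ?thesis
    using J_entry[OF assms] \<iota>_eqD[OF assms] by (auto simp: jordan_entry_def one_pCons)
qed

text \<open>The edges of the bipartite graph whose perfect matchings between \<open>I\<close> and
  \<open>K\<close> are the nonzero terms of a minor.\<close>

definition adj :: "nat \<Rightarrow> nat \<Rightarrow> bool" where
  "adj r c \<longleftrightarrow> c = r \<or> blk c = blk r \<and> off c = Suc (off r)"

lemma adj_iff: "r < n \<Longrightarrow> c < n \<Longrightarrow> char_poly_matrix J $$ (r, c) \<noteq> 0 \<longleftrightarrow> adj r c"
  by (auto simp: char_matrix_entry adj_def)

text \<open>Starting from the last row of the block, all entries are forced to lie on the diagonal.\<close>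

lemma matching_full_block:
  assumes inj: "inj_on \<sigma> I" and adj: "\<And>r. r \<in> I \<Longrightarrow> \<sigma> r < n \<and> adj r (\<sigma> r)"
    and full: "\<And>r. r < n \<Longrightarrow> blk r = b \<Longrightarrow> r \<in> I"
    and r: "r < n" "blk r = b"
  shows "\<sigma> r = r"
  using r
proof (induction "s b - off r" arbitrary: r rule: less_induct)
  case less
  show ?case
  proof (rule ccontr)
    assume ne: "\<sigma> r \<noteq> r"
    have rI: "r \<in> I" using full less.prems by blast
    have \<sigma>r: "\<sigma> r < n" "blk (\<sigma> r) = b" "off (\<sigma> r) = Suc (off r)"
      using adj[OF rI] ne less.prems by (auto simp: adj_def)
    have "off (\<sigma> r) < s b" using blk_off(2)[OF \<sigma>r(1)] \<sigma>r(2) by simp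
    \<comment> \<open>By induction the next row of the block already occupies the column that
      \<open>r\<close> would take.\<close>
    then have "\<sigma> (\<sigma> r) = \<sigma> r" using less.hyps[of "\<sigma> r"] \<sigma>r by auto
    then have "\<sigma> r = r" using inj full[OF \<sigma>r(1,2)] rI by (metis inj_onD)
    then show False using ne by simp
  qed
qed

text \<open>Without the last row and the first column, all entries are forced to the superdiagonal.\<close>

lemma matching_cut_block:
  assumes inj: "inj_on \<sigma> I" and adj: "\<And>r. r \<in> I \<Longrightarrow> \<sigma> r < n \<and> adj r (\<sigma> r)"
    and full: "\<And>r. r < n \<Longrightarrow> blk r = b \<Longrightarrow> Suc (off r) < s b \<Longrightarrow> r \<in> I"
    and first: "\<And>r. r \<in> I \<Longrightarrow> blk r = b \<Longrightarrow> off (\<sigma> r) \<noteq> 0"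
    and r: "r < n" "blk r = b" "Suc (off r) < s b"
  shows "\<sigma> r = index b (Suc (off r))"
  using r
proof (induction "off r" arbitrary: r rule: less_induct)
  case less
  have rI: "r \<in> I" using full less.prems by blast
  have bB: "b \<in> B" using blk_off(1)[OF less.prems(1)] less.prems(2) by simp
  \<comment> \<open>The diagonal column is either the excluded first column or, by induction, taken
    by the preceding row of the block.\<close>
  have "\<sigma> r \<noteq> r"
  proof
    assume eq: "\<sigma> r = r"
    then have "off r \<noteq> 0" using first[OF rI less.prems(2)] by simp
    then obtain i where i: "off r = Suc i" by (cases "off r") auto
    define r' where "r' = index b i"
    have r': "r' < n" "\<iota> r' = (b, i)" using index[OF bB, of i] less.prems i by (simp_all add: r'_def)
    have "\<sigma> r' = index b (Suc i)" using less.hyps[of r'] r' i less.prems by simp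
    also have "\<dots> = r"
      by (rule index_eqI[symmetric]) (use less.prems i in auto)
    finally have "r' = r" using eq inj full[of r'] r' rI i less.prems
      by (metis Suc_lessD fst_conv inj_onD snd_conv)
    then show False using r' i by simp
  qed
  then have "\<sigma> r < n" "blk (\<sigma> r) = b" "off (\<sigma> r) = Suc (off r)"
    using adj[OF rI] less.prems by (auto simp: adj_def)
  then show ?case by (rule index_eqI)
qed

text \<open>Deleting \<open>j\<close> rows touches a set \<open>U\<close> of at most
  \<open>j\<close> blocks. In each nonzero term an untouched block is matched along its diagonal and
  contributes its full power.\<close>

lemma minor_dvd:
  assumes I: "I \<subseteq> {..<n}" "K \<subseteq> {..<n}" "card I = n - j" "card K = n - j" and j: "j \<le> n"
    and E: "\<And>U. U \<subseteq> B \<Longrightarrow> card U \<le> j \<Longrightarrow> E dvd (\<Prod>b\<in>B - U. [:- l b, 1:] ^ s b)"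
  shows "E dvd Determinant.det (submatrix (char_poly_matrix J) I K)"
proof (rule dvd_det_submatrix)
  show "I \<subseteq> {..<dim_row (char_poly_matrix J)}" "K \<subseteq> {..<dim_col (char_poly_matrix J)}" "card I = card K"
    using I char_poly_matrix_closed[OF J] by auto
  fix \<sigma> assume \<sigma>: "bij_betw \<sigma> I K"
  let ?A = "char_poly_matrix J"
  have finI: "finite I" using I finite_subset by blast
  show "E dvd (\<Prod>r\<in>I. ?A $$ (r, \<sigma> r))"
  proof (cases "\<forall>r\<in>I. ?A $$ (r, \<sigma> r) \<noteq> 0")
    case False
    then have "(\<Prod>r\<in>I. ?A $$ (r, \<sigma> r)) = 0" using finI by auto
    then show ?thesis by simp
  next
    case True
    have \<sigma>n: "\<sigma> r < n" if "r \<in> I" for r using \<sigma> that I by (auto simp: bij_betw_def)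
    have adj: "\<sigma> r < n \<and> adj r (\<sigma> r)" if "r \<in> I" for r
      using True adj_iff[of r "\<sigma> r"] \<sigma>n that I by auto
    define U where "U = blk ` ({..<n} - I)"
    have "card U \<le> card ({..<n} - I)" unfolding U_def by (rule card_image_le) simp
    also have "\<dots> = j" using I finI j by (simp add: card_Diff_subset)
    finally have "card U \<le> j" .
    moreover have "U \<subseteq> B" using blk_off by (auto simp: U_def)
    ultimately have "E dvd (\<Prod>b\<in>B - U. [:- l b, 1:] ^ s b)" using E by blast
    also have "\<dots> = (\<Prod>b\<in>B - U. \<Prod>r\<in>{r. r < n \<and> blk r = b}. ?A $$ (r, \<sigma> r))"
    proof (rule prod.cong[OF refl])
      fix b assume b: "b \<in> B - U"
      have full: "r \<in> I" if "r < n" "blk r = b" for r using b that by (auto simp: U_def)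
      have "\<sigma> r = r" if "r < n" "blk r = b" for r
        by (rule matching_full_block[OF bij_betw_imp_inj_on[OF \<sigma>] adj full that])
      then have "(\<Prod>r\<in>{r. r < n \<and> blk r = b}. ?A $$ (r, \<sigma> r)) = (\<Prod>r\<in>{r. r < n \<and> blk r = b}. [:- l b, 1:])"
        by (intro prod.cong refl) (auto simp: char_matrix_entry)
      then show "[:- l b, 1:] ^ s b = (\<Prod>r\<in>{r. r < n \<and> blk r = b}. ?A $$ (r, \<sigma> r))"
        using card_blk[of b] b by simp
    qed
    also have "\<dots> = (\<Prod>r\<in>(\<Union>b\<in>B - U. {r. r < n \<and> blk r = b}). ?A $$ (r, \<sigma> r))"
      by (rule prod.UNION_disjoint[symmetric]) (use fin in auto)
    also have "\<dots> dvd (\<Prod>r\<in>I. ?A $$ (r, \<sigma> r))"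
      by (rule prod_dvd_prod_subset[OF finI]) (auto simp: U_def)
    finally show ?thesis .
  qed
qed

text \<open>The rows \<open>R\<close> omit the last row of every block in \<open>T\<close>;
  \<open>\<tau>\<close> runs along the superdiagonal in these blocks and along the diagonal
  elsewhere. Superdiagonal entries are \<open>- 1\<close>, so only blocks outside \<open>T\<close>
  contribute to the multiplicity of \<open>c\<close>. The conclusion speaks of divisors of the minor
  because it is applied to the gcd.\<close>

lemma exists_minor_order_le:
  assumes T: "T \<subseteq> B" "card T \<le> j" and j: "j \<le> n"
  obtains I K where "I \<subseteq> {..<n}" "K \<subseteq> {..<n}" "card I = n - j" "card K = n - j"
    "\<And>q. q dvd Determinant.det (submatrix (char_poly_matrix J) I K) \<Longrightarrow>
      q \<noteq> 0 \<and> Polynomial.order c q \<le> (\<Sum>b\<in>{b\<in>B. l b = c} - T. s b)"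
proof -
  let ?A = "char_poly_matrix J"
  have finT: "finite T" by (rule finite_subset[OF T(1) fin])
  define R where "R = {r. r < n \<and> \<not> (blk r \<in> T \<and> Suc (off r) = s (blk r))}"
  define \<tau> where "\<tau> r = (if blk r \<in> T then index (blk r) (Suc (off r)) else r)" for r
  have R_T: "Suc (off r) < s (blk r)" "r < n" if "r \<in> R" "blk r \<in> T" for r
    using blk_off[of r] that by (auto simp: R_def)
  have \<tau>: "\<tau> r < n \<and> adj r (\<tau> r)" "blk r \<in> T \<Longrightarrow> \<iota> (\<tau> r) = (blk r, Suc (off r))" "blk (\<tau> r) = blk r"
    if "r \<in> R" for r
    using index[of "blk r" "Suc (off r)"] R_T[of r] that T by (auto simp: \<tau>_def adj_def R_def)
  have \<tau>_inj: "inj_on \<tau> R"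
  proof (rule inj_onI)
    fix x y assume xy: "x \<in> R" "y \<in> R" "\<tau> x = \<tau> y"
    then have blk: "blk x = blk y" using \<tau>(3) by metis
    show "x = y"
    proof (cases "blk x \<in> T")
      case True
      then have "off x = off y" using \<tau>(2)[OF xy(1)] \<tau>(2)[OF xy(2)] blk xy(3) by auto
      then show ?thesis using \<iota>_eqD blk xy by (auto simp: R_def)
    next
      case False
      then show ?thesis using xy(3) blk by (simp add: \<tau>_def)
    qed
  qed
  have "card R = n - card T"
  proof -
    have "R = {..<n} - (\<lambda>b. index b (s b - 1)) ` T"
    proof (intro equalityI subsetI)
      fix r assume "r \<in> R"
      moreover have "\<iota> (index b (s b - 1)) = (b, s b - 1)" "Suc (s b - 1) = s b" if "b \<in> T" for b
        using that T pos[of b] index[of b "s b - 1"] by auto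
      ultimately show "r \<in> {..<n} - (\<lambda>b. index b (s b - 1)) ` T" by (auto simp: R_def)
    next
      fix r assume r: "r \<in> {..<n} - (\<lambda>b. index b (s b - 1)) ` T"
      have "r = index (blk r) (s (blk r) - 1)" if "Suc (off r) = s (blk r)"
        by (rule index_eqI) (use r that in auto)
      then show "r \<in> R" using r by (auto simp: R_def)
    qed
    moreover have "inj_on (\<lambda>b. index b (s b - 1)) T"
    proof (rule inj_on_inverseI[of _ blk])
      fix b assume "b \<in> T"
      then have "b \<in> B" "s b - 1 < s b" using T pos[of b] by auto
      then show "blk (index b (s b - 1)) = b" by (simp add: index)
    qed
    moreover have "(\<lambda>b. index b (s b - 1)) ` T \<subseteq> {..<n}"
    proof clarify
      fix b assume "b \<in> T"
      then have "b \<in> B" "s b - 1 < s b" using T pos[of b] by auto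
      then show "index b (s b - 1) < n" by (rule index)
    qed
    ultimately show ?thesis using finT by (simp add: card_Diff_subset card_image)
  qed
  then have "n - j \<le> card R" using T by simp
  \<comment> \<open>If \<open>T\<close> has fewer than \<open>j\<close> blocks, surplus rows are
    dropped together with their \<open>\<tau>\<close>-columns, which can only lower the
    multiplicity.\<close>
  then obtain I where I: "I \<subseteq> R" "card I = n - j" by (meson obtain_subset_with_card_n)
  have In: "I \<subseteq> {..<n}" using I by (auto simp: R_def)
  have finI: "finite I" using In finite_subset by blast
  have \<tau>_bij: "bij_betw \<tau> I (\<tau> ` I)" using \<tau>_inj I by (meson inj_on_imp_bij_betw inj_on_subset)
  have det: "Determinant.det (submatrix ?A I (\<tau> ` I)) dvd (\<Prod>r\<in>I. ?A $$ (r, \<tau> r))"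
  proof (rule det_submatrix_unique_dvd[OF _ _ _ \<tau>_bij])
    show "I \<subseteq> {..<dim_row ?A}" "\<tau> ` I \<subseteq> {..<dim_col ?A}"
      using In I \<tau>(1) char_poly_matrix_closed[OF J] by auto
    show "card I = card (\<tau> ` I)" using \<tau>_bij by (rule bij_betw_same_card)
    fix \<sigma> r assume \<sigma>: "bij_betw \<sigma> I (\<tau> ` I)" and nz: "\<And>r. r \<in> I \<Longrightarrow> ?A $$ (r, \<sigma> r) \<noteq> 0" and r: "r \<in> I"
    \<comment> \<open>A competing matching is extended by \<open>\<tau>\<close> to all of
      \<open>R\<close>, because the forcing lemmas need every row of a full or cut block.\<close>
    define \<sigma>' where "\<sigma>' r = (if r \<in> I then \<sigma> r else \<tau> r)" for r
    have \<sigma>I: "\<sigma> ` I = \<tau> ` I" "inj_on \<sigma> I" using \<sigma> by (auto simp: bij_betw_def)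
    have \<sigma>'_inj: "inj_on \<sigma>' R"
    proof -
      have "inj_on \<sigma>' (I \<union> (R - I))"
        unfolding inj_on_Un
      proof (intro conjI)
        show "inj_on \<sigma>' I" using \<sigma>I(2) by (simp add: \<sigma>'_def inj_on_def)
        show "inj_on \<sigma>' (R - I)" using \<tau>_inj by (simp add: \<sigma>'_def inj_on_def)
        have "\<sigma>' ` I = \<tau> ` I" using \<sigma>I(1) by (simp add: \<sigma>'_def)
        moreover have "\<sigma>' ` (R - I) = \<tau> ` (R - I)" by (simp add: \<sigma>'_def)
        moreover have "\<tau> ` I \<inter> \<tau> ` (R - I) = {}"
          using inj_on_image_Int[OF \<tau>_inj I(1), of "R - I"] by simp
        moreover have "I - (R - I) = I" "R - I - I = R - I" by auto
        ultimately show "\<sigma>' ` (I - (R - I)) \<inter> \<sigma>' ` (R - I - I) = {}" by simp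
      qed
      then show ?thesis using I by (simp add: Un_absorb1)
    qed
    have \<sigma>'_adj: "\<sigma>' x < n \<and> adj x (\<sigma>' x)" if "x \<in> R" for x
    proof (cases "x \<in> I")
      case True
      then have "\<sigma> x \<in> \<tau> ` I" using \<sigma>I(1) by blast
      then have "\<sigma> x < n" using \<tau>(1) I(1) by auto
      then show ?thesis using True nz adj_iff[of x "\<sigma> x"] In by (auto simp: \<sigma>'_def)
    next
      case False
      then show ?thesis using \<tau>(1)[OF that] by (simp add: \<sigma>'_def)
    qed
    have rR: "r \<in> R" "r < n" using r I In by auto
    have "\<sigma>' r = \<tau> r"
    proof (cases "blk r \<in> T")
      case True
      have "\<sigma>' r = index (blk r) (Suc (off r))"
      proof (rule matching_cut_block[OF \<sigma>'_inj \<sigma>'_adj _ _ rR(2) refl])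
        show "Suc (off r) < s (blk r)" using R_T rR True by blast
        show "x \<in> R" if "x < n" "blk x = blk r" "Suc (off x) < s (blk r)" for x
          using that by (auto simp: R_def)
        fix x assume x: "x \<in> R" "blk x = blk r"
        \<comment> \<open>The columns used are those of \<open>\<tau>\<close>, and inside a block of
          \<open>T\<close> these have positive offset.\<close>
        have "\<sigma>' x \<in> \<tau> ` R" using \<sigma>I(1) I x(1) by (auto simp: \<sigma>'_def)
        then obtain y where y: "y \<in> R" "\<sigma>' x = \<tau> y" by blast
        have "blk (\<sigma>' x) = blk x" using \<sigma>'_adj[OF x(1)] by (auto simp: adj_def)
        then have "blk y \<in> T" using y \<tau>(3)[OF y(1)] x(2) True by simp
        then show "off (\<sigma>' x) \<noteq> 0" using \<tau>(2)[OF y(1)] y(2) by simp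
      qed
      then show ?thesis using True by (simp add: \<tau>_def)
    next
      case False
      then have "\<sigma>' r = r"
        by (intro matching_full_block[OF \<sigma>'_inj \<sigma>'_adj _ rR(2) refl]) (auto simp: R_def)
      then show ?thesis using False by (simp add: \<tau>_def)
    qed
    then show "\<sigma> r = \<tau> r" using r by (simp add: \<sigma>'_def)
  qed
  have entry: "?A $$ (r, \<tau> r) = (if blk r \<in> T then - 1 else [:- l (blk r), 1:])" if "r \<in> I" for r
  proof -
    have rR: "r \<in> R" "r < n" using that I In by auto
    show ?thesis
    proof (cases "blk r \<in> T")
      case True
      then have "\<iota> (\<tau> r) = (blk r, Suc (off r))" by (rule \<tau>(2)[OF rR(1)])
      moreover from this have "r \<noteq> \<tau> r" by (metis n_not_Suc_n snd_conv)
      ultimately show ?thesis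
        using char_matrix_entry[OF rR(2) conjunct1[OF \<tau>(1)[OF rR(1)]]] True by simp
    next
      case False
      then show ?thesis using char_matrix_entry[OF rR(2) rR(2)] by (simp add: \<tau>_def)
    qed
  qed
  have nz: "(\<Prod>r\<in>I. ?A $$ (r, \<tau> r)) \<noteq> 0" using finI by (auto simp: entry)
  have "Polynomial.order c (\<Prod>r\<in>I. ?A $$ (r, \<tau> r)) = (\<Sum>r\<in>I. Polynomial.order c (?A $$ (r, \<tau> r)))"
    by (rule order_prod[OF finI]) (simp add: entry)
  also have "\<dots> = (\<Sum>r\<in>I. if blk r \<notin> T \<and> l (blk r) = c then 1 else 0)"
  proof (rule sum.cong[OF refl])
    fix r assume r: "r \<in> I"
    have "Polynomial.order c [:- d, 1:] = (if d = c then 1 else 0)" for d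
    proof (cases "d = c")
      case True
      then show ?thesis using order_power_n_n[of c 1] by simp
    qed (simp add: order_0I)
    moreover have "Polynomial.order c (- 1) = 0" by (simp add: order_0I)
    ultimately show "Polynomial.order c (?A $$ (r, \<tau> r)) = (if blk r \<notin> T \<and> l (blk r) = c then 1 else 0)"
      using r by (simp add: entry)
  qed
  also have "\<dots> = card {r\<in>I. blk r \<notin> T \<and> l (blk r) = c}"
    using finI by (simp add: sum.If_cases Int_def)
  also have "\<dots> \<le> card (\<Union>b\<in>{b\<in>B. l b = c} - T. {r. r < n \<and> blk r = b})"
    by (rule card_mono) (use fin In blk_off in auto)
  also have "\<dots> \<le> (\<Sum>b\<in>{b\<in>B. l b = c} - T. card {r. r < n \<and> blk r = b})"
    by (rule card_UN_le) (use fin in auto)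
  also have "\<dots> = (\<Sum>b\<in>{b\<in>B. l b = c} - T. s b)" by (simp add: card_blk)
  finally have ord: "Polynomial.order c (\<Prod>r\<in>I. ?A $$ (r, \<tau> r)) \<le> (\<Sum>b\<in>{b\<in>B. l b = c} - T. s b)" .
  show ?thesis
  proof (rule that[OF In])
    show "\<tau> ` I \<subseteq> {..<n}" using \<tau>(1) I by auto
    show "card I = n - j" "card (\<tau> ` I) = n - j" using I bij_betw_same_card[OF \<tau>_bij] by auto
    fix q assume "q dvd Determinant.det (submatrix ?A I (\<tau> ` I))"
    then have q: "q dvd (\<Prod>r\<in>I. ?A $$ (r, \<tau> r))" using det dvd_trans by blast
    then show "q \<noteq> 0 \<and> Polynomial.order c q \<le> (\<Sum>b\<in>{b\<in>B. l b = c} - T. s b)"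
      using nz ord dvd_imp_order_le[OF nz q, of c] by auto
  qed
qed

text \<open>\<open>E\<close> divides every minor and hence their gcd. In the other direction
  multiplicities are compared root by root, so the set \<open>T\<close> and the minor built from it
  may depend on \<open>c\<close>.\<close>

lemma det_divisor_eq:
  assumes j: "j \<le> n"
    and E: "\<And>U. U \<subseteq> B \<Longrightarrow> card U \<le> j \<Longrightarrow> E dvd (\<Prod>b\<in>B - U. [:- l b, 1:] ^ s b)"
    and T: "\<And>c. \<exists>T\<subseteq>B. card T \<le> j \<and> (\<Sum>b\<in>{b\<in>B. l b = c} - T. s b) \<le> Polynomial.order c E"
  obtains u where "det_divisor J (n - j) = E * u" "u dvd 1" "degree (det_divisor J (n - j)) = degree E"
    "det_divisor J (n - j) \<noteq> 0"
proof -
  let ?D = "det_divisor J (n - j)"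
  have D_dvd: "?D dvd Determinant.det (submatrix (char_poly_matrix J) I K)"
    if "I \<subseteq> {..<n}" "K \<subseteq> {..<n}" "card I = n - j" "card K = n - j" for I K
    unfolding det_divisor_def by (rule Gcd_dvd) (use that J in auto)
  have E_dvd: "E dvd ?D"
    unfolding det_divisor_def
  proof (rule Gcd_greatest)
    fix q assume "q \<in> {Determinant.det (submatrix (char_poly_matrix J) I K) |I K.
          I \<subseteq> {..<dim_row J} \<and> K \<subseteq> {..<dim_col J} \<and> card I = n - j \<and> card K = n - j}"
    then show "E dvd q" using J by (auto intro!: minor_dvd[OF _ _ _ _ j E])
  qed
  have ord: "?D \<noteq> 0 \<and> Polynomial.order c ?D \<le> Polynomial.order c E" for c
  proof -
    obtain T where T': "T \<subseteq> B" "card T \<le> j" "(\<Sum>b\<in>{b\<in>B. l b = c} - T. s b) \<le> Polynomial.order c E"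
      using T by blast
    obtain I K where IK: "I \<subseteq> {..<n}" "K \<subseteq> {..<n}" "card I = n - j" "card K = n - j"
      "\<And>q. q dvd Determinant.det (submatrix (char_poly_matrix J) I K) \<Longrightarrow>
        q \<noteq> 0 \<and> Polynomial.order c q \<le> (\<Sum>b\<in>{b\<in>B. l b = c} - T. s b)"
      using exists_minor_order_le[OF T'(1,2) j, where c = c] by blast
    show ?thesis using IK(5)[OF D_dvd[OF IK(1-4)]] T'(3) by auto
  qed
  show ?thesis
    by (rule degree_eq_of_dvd_order_le[OF E_dvd]) (use ord that in auto)
qed

end

section \<open>Dimension of the similarity class\<close>

text \<open>Induction on the list: prepending a block of order \<open>k\<close> shifts the old rows
  by \<open>k\<close> and the old block numbers by one.\<close>

lemma jordan_matrix_entries: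
  "\<exists>g. bij_betw g {..<sum_list (map fst bl)} (SIGMA b:{..<length bl}. {..<fst (bl ! b)}) \<and>
     (\<forall>r<sum_list (map fst bl). \<forall>c<sum_list (map fst bl).
       jordan_matrix bl $$ (r, c) = jordan_entry (\<lambda>b. snd (bl ! b)) (g r) (g c))"
proof (induction bl)
  case Nil
  have "(SIGMA b:{..<length []}. {..<fst (([] :: (nat \<times> complex) list) ! b)}) = {}" by simp
  then show ?case by (intro exI[of _ "\<lambda>_. (0, 0)"]) (simp add: bij_betw_def)
next
  case (Cons ka bl)
  obtain k a where ka: "ka = (k, a)" by (cases ka)
  define n where "n = sum_list (map fst bl)"
  obtain g where g: "bij_betw g {..<n} (SIGMA b:{..<length bl}. {..<fst (bl ! b)})"
    and J: "\<And>r c. r < n \<Longrightarrow> c < n \<Longrightarrow> jordan_matrix bl $$ (r, c) = jordan_entry (\<lambda>b. snd (bl ! b)) (g r) (g c)"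
    using Cons unfolding n_def by blast
  define h where "h r = (if r < k then (0, r) else (Suc (fst (g (r - k))), snd (g (r - k))))" for r
  have "bij_betw h {..<k} ({0} \<times> {..<k})"
    by (rule bij_betw_byWitness[where f' = snd]) (auto simp: h_def)
  moreover have "bij_betw h {k..<k + n} (SIGMA b:{1..<Suc (length bl)}. {..<fst ((ka # bl) ! b)})"
  proof -
    have 1: "bij_betw (\<lambda>r. r - k) {k..<k + n} {..<n}"
      by (rule bij_betw_byWitness[where f' = "\<lambda>r. r + k"]) auto
    have 2: "bij_betw (\<lambda>(b, i). (Suc b, i)) (SIGMA b:{..<length bl}. {..<fst (bl ! b)})
        (SIGMA b:{1..<Suc (length bl)}. {..<fst ((ka # bl) ! b)})"
      by (rule bij_betw_byWitness[where f' = "\<lambda>(b, i). (b - 1, i)"]) auto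
    have "bij_betw ((\<lambda>(b, i). (Suc b, i)) \<circ> (g \<circ> (\<lambda>r. r - k))) {k..<k + n}
        (SIGMA b:{1..<Suc (length bl)}. {..<fst ((ka # bl) ! b)})"
      by (rule bij_betw_trans[OF bij_betw_trans[OF 1 g] 2])
    then show ?thesis
      by (rule bij_betw_cong[THEN iffD1, rotated]) (simp add: h_def case_prod_unfold)
  qed
  ultimately have "bij_betw h ({..<k} \<union> {k..<k + n})
      (({0} \<times> {..<k}) \<union> (SIGMA b:{1..<Suc (length bl)}. {..<fst ((ka # bl) ! b)}))"
    by (rule bij_betw_combine) auto
  moreover have "{..<k} \<union> {k..<k + n} = {..<sum_list (map fst (ka # bl))}" by (auto simp: ka n_def)
  moreover have "({0} \<times> {..<k}) \<union> (SIGMA b:{1..<Suc (length bl)}. {..<fst ((ka # bl) ! b)})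
      = (SIGMA b:{..<length (ka # bl)}. {..<fst ((ka # bl) ! b)})"
    by (auto simp: ka nth_Cons split: nat.splits)
  ultimately have bij: "bij_betw h {..<sum_list (map fst (ka # bl))}
      (SIGMA b:{..<length (ka # bl)}. {..<fst ((ka # bl) ! b)})" by simp
  have "jordan_matrix (ka # bl) $$ (r, c) = jordan_entry (\<lambda>b. snd ((ka # bl) ! b)) (h r) (h c)"
    if "r < k + n" "c < k + n" for r c
    using that J[of "r - k" "c - k"]
    by (auto simp: ka jordan_matrix_Cons n_def[symmetric] h_def jordan_entry_def jordan_block_def)
  with bij show ?case by (intro exI[of _ h]) (simp add: ka n_def)
qed

text \<open>The hypothesis on the blocks determines them only up to order; this turns it into a
  renumbering \<open>h\<close> of list positions.\<close>

lemma mset_eq_image_mset_setD: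
  assumes "mset xs = image_mset f (mset_set L)" "finite L"
  obtains h where "bij_betw h {..<length xs} L" "\<And>i. i < length xs \<Longrightarrow> xs ! i = f (h i)"
proof -
  obtain ys where ys: "set ys = L" "distinct ys" using finite_distinct_list[OF assms(2)] by blast
  have "mset xs = mset (map f ys)"
    using assms(1) ys mset_set_set[OF ys(2)] by simp
  then obtain p where p: "p permutes {..<length (map f ys)}" "permute_list p (map f ys) = xs"
    using mset_eq_permutation by blast
  have len: "length xs = length ys" using p(2) by auto
  have "bij_betw (\<lambda>i. ys ! i) {..<length ys} L" using ys by (intro bij_betw_nth) auto
  then have "bij_betw ((\<lambda>i. ys ! i) \<circ> p) {..<length xs} L"
    unfolding len by (rule bij_betw_trans[rotated]) (use permutes_imp_bij[OF p(1)] in simp)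
  moreover have "xs ! i = f (((\<lambda>i. ys ! i) \<circ> p) i)" if "i < length xs" for i
  proof -
    have "p i < length ys" using permutes_in_image[OF p(1), of i] that len by simp
    moreover have "xs ! i = map f ys ! p i"
      using permute_list_nth[OF p(1), of i] p(2) that len by simp
    ultimately show ?thesis by simp
  qed
  ultimately show ?thesis by (rule that)
qed

text \<open>The odd weights arise here: passing to \<open>Suc N\<close> adds
  \<open>2 * N + 1\<close> pairs, and for all of them the minimum is
  \<open>f (Suc N)\<close>.\<close>

lemma sum_min_antimono:
  fixes f :: "nat \<Rightarrow> nat"
  assumes "\<And>i j. 1 \<le> i \<Longrightarrow> i \<le> j \<Longrightarrow> j \<le> N \<Longrightarrow> f j \<le> f i"
  shows "(\<Sum>i=1..N. \<Sum>j=1..N. min (f i) (f j)) = (\<Sum>j=1..N. (2 * j - 1) * f j)"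
  using assms
proof (induction N)
  case (Suc N)
  have m: "min (f i) (f (Suc N)) = f (Suc N)" "min (f (Suc N)) (f i) = f (Suc N)" if "i \<in> {1..N}" for i
    using Suc.prems[of i "Suc N"] that by auto
  have "(\<Sum>i=1..Suc N. \<Sum>j=1..Suc N. min (f i) (f j))
      = (\<Sum>i=1..N. \<Sum>j=1..N. min (f i) (f j)) + (\<Sum>i=1..N. min (f i) (f (Suc N)))
        + (\<Sum>j=1..N. min (f (Suc N)) (f j)) + f (Suc N)"
    by (simp add: sum.distrib)
  also have "\<dots> = (\<Sum>j=1..N. (2 * j - 1) * f j) + (2 * Suc N - 1) * f (Suc N)"
    using Suc.IH Suc.prems by (simp add: m algebra_simps)
  finally show ?case by simp
qed simp

text \<open>The largest element \<open>x\<close> of \<open>V\<close> is at least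
  \<open>card V\<close>, so \<open>f x \<le> f (card V)\<close>; the rest follows by removing
  \<open>x\<close>.\<close>

lemma sum_le_initial_sum:
  fixes f :: "nat \<Rightarrow> nat"
  assumes mono: "\<And>i j. 1 \<le> i \<Longrightarrow> i \<le> j \<Longrightarrow> j \<le> N \<Longrightarrow> f j \<le> f i" and V: "V \<subseteq> {1..N}"
  shows "sum f V \<le> sum f {1..card V}"
  using V
proof (induction "card V" arbitrary: V)
  case 0
  then have "V = {}" using finite_subset[of V "{1..N}"] by simp
  then show ?case by simp
next
  case (Suc m)
  have fin: "finite V" using Suc.prems finite_subset by blast
  then have ne: "V \<noteq> {}" using Suc.hyps(2) by auto
  define x where "x = Max V"
  have x: "x \<in> V" using fin ne by (simp add: x_def)
  have "V \<subseteq> {1..x}" using fin Suc.prems by (auto simp: x_def)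
  then have "card V \<le> x" using card_mono[of "{1..x}" V] by simp
  then have "f x \<le> f (Suc m)" using mono[of "Suc m" x] x Suc.prems Suc.hyps(2) by auto
  moreover have card: "m = card (V - {x})" using Suc.hyps(2) x fin by simp
  have "sum f (V - {x}) \<le> sum f {1..m}"
    using Suc.hyps(1)[OF card] Suc.prems by (simp only: card) auto
  ultimately show ?case
    using sum.remove[OF fin x, of f] by (simp add: Suc.hyps(2)[symmetric])
qed

text \<open>The complementary form: omitting at most \<open>j\<close> terms removes no more than the
  first \<open>j\<close> terms, which are the largest.\<close>

lemma sum_tail_le_sum_Diff:
  fixes f :: "nat \<Rightarrow> nat"
  assumes mono: "\<And>i j. 1 \<le> i \<Longrightarrow> i \<le> j \<Longrightarrow> j \<le> N \<Longrightarrow> f j \<le> f i"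
    and V: "V \<subseteq> {1..N}" "card V \<le> j"
  shows "sum f {j<..N} \<le> sum f ({1..N} - V)"
proof -
  have "card V \<le> N" using card_mono[OF _ V(1)] by simp
  have "sum f {j<..N} + sum f {1..min j N} = sum f ({j<..N} \<union> {1..min j N})"
    by (rule sum.union_disjoint[symmetric]) auto
  also have "{j<..N} \<union> {1..min j N} = {1..N}" by auto
  also have "sum f {1..N} = sum f ({1..N} - V) + sum f V"
    by (rule sum.subset_diff[OF V(1)]) simp
  also have "sum f V \<le> sum f {1..card V}" by (rule sum_le_initial_sum[OF mono V(1)])
  also have "\<dots> \<le> sum f {1..min j N}"
    by (rule sum_mono2) (use V(2) \<open>card V \<le> N\<close> in auto)
  finally show ?thesis by simp
qed

section \<open>The matrix algebra in coordinates\<close>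

definition vec_times :: "complex ^ ('n::finite \<times> 'n) \<Rightarrow> complex ^ ('n \<times> 'n) \<Rightarrow> complex ^ ('n \<times> 'n)" where
  "vec_times x y = (\<chi> rc. \<Sum>k\<in>UNIV. x $ (fst rc, k) * y $ (k, snd rc))"

definition vec_one :: "complex ^ ('n::finite \<times> 'n)" where
  "vec_one = (\<chi> rc. if fst rc = snd rc then 1 else 0)"

interpretation mat_alg: complex_algebra "vec_times :: complex ^ ('n::finite \<times> 'n) \<Rightarrow> _" vec_one
proof
  fix x y z :: "complex ^ ('n \<times> 'n)"
  show "vec_times (vec_times x y) z = vec_times x (vec_times y z)"
  proof -
    have "(\<Sum>k\<in>UNIV. (\<Sum>i\<in>UNIV. x $ (r, i) * y $ (i, k)) * z $ (k, c))
        = (\<Sum>i\<in>UNIV. x $ (r, i) * (\<Sum>k\<in>UNIV. y $ (i, k) * z $ (k, c)))" for r c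
      unfolding sum_distrib_left sum_distrib_right by (subst sum.swap) (simp add: mult.assoc)
    then show ?thesis by (simp add: vec_times_def)
  qed
  show "vec_times vec_one x = x" "vec_times x vec_one = x"
    by (simp_all add: vec_times_def vec_one_def Finite_Cartesian_Product.vec_eq_iff
        if_distrib[of "\<lambda>t. t * _"] if_distrib[of "\<lambda>t. _ * t"] cong: if_cong)
qed (simp_all add: vec_times_def Finite_Cartesian_Product.vec_eq_iff algebra_simps sum.distrib
    sum_distrib_left)

lemma mat_coords_times:
  assumes e: "bij_betw e UNIV {..<n}" and A: "A \<in> carrier_mat n n" and B: "B \<in> carrier_mat n n"
  shows "mat_coords e (A * B) = vec_times (mat_coords e A) (mat_coords e B)"
proof -
  have en: "e i < n" for i using e by (auto simp: bij_betw_def)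
  have "(A * B) $$ (e r, e c) = (\<Sum>k\<in>UNIV. A $$ (e r, e k) * B $$ (e k, e c))" for r c
  proof -
    have "(A * B) $$ (e r, e c) = (\<Sum>k\<in>{..<n}. A $$ (e r, k) * B $$ (k, e c))"
      using A B en by (simp add: scalar_prod_def lessThan_atLeast0)
    also have "\<dots> = (\<Sum>k\<in>UNIV. A $$ (e r, e k) * B $$ (e k, e c))"
      by (rule sum.reindex_bij_betw[OF e, symmetric])
    finally show ?thesis .
  qed
  then show ?thesis by (simp add: mat_coords_def vec_times_def)
qed

lemma mat_coords_one:
  assumes e: "bij_betw e UNIV {..<n}"
  shows "mat_coords e (1\<^sub>m n) = vec_one"
proof -
  have "e i < n" "e i = e j \<longleftrightarrow> i = j" for i j using e by (auto simp: bij_betw_def inj_on_def)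
  then show ?thesis by (simp add: mat_coords_def vec_one_def)
qed

lemma mat_coords_bij:
  assumes e: "bij_betw e UNIV {..<n}"
  shows "bij_betw (mat_coords e) (carrier_mat n n) UNIV"
proof (rule bij_betw_byWitness[where f' = "\<lambda>x. mat n n (\<lambda>(i, j). x $ (inv_into UNIV e i, inv_into UNIV e j))"])
  have e': "e i < n" "inv_into UNIV e (e i) = i" for i using e by (auto simp: bij_betw_def)
  have e'': "e (inv_into UNIV e i) = i" if "i < n" for i
    using e that f_inv_into_f[of i e UNIV] by (auto simp: bij_betw_def)
  show "\<forall>A\<in>carrier_mat n n. mat n n (\<lambda>(i, j). mat_coords e A $ (inv_into UNIV e i, inv_into UNIV e j)) = A"
    by (auto intro!: eq_matI simp: mat_coords_def e'')
  show "\<forall>x\<in>UNIV. mat_coords e (mat n n (\<lambda>(i, j). x $ (inv_into UNIV e i, inv_into UNIV e j))) = x"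
    by (simp add: mat_coords_def e' Finite_Cartesian_Product.vec_eq_iff)
qed auto

text \<open>\<open>mat_coords e\<close> is a bijection compatible with products and the unit, so
  invertible matrices correspond to units and similarity to conjugacy.\<close>

lemma mat_coords_similarity_class:
  assumes e: "bij_betw e UNIV {..<n}" and J: "J \<in> carrier_mat n n"
  shows "mat_coords e ` similarity_class n J = mat_alg.conj_class (mat_coords e J)"
proof (intro equalityI subsetI)
  fix x assume "x \<in> mat_coords e ` similarity_class n J"
  then obtain A P Q where A: "x = mat_coords e A" "A \<in> carrier_mat n n" "similar_mat_wit A J P Q"
    by (auto simp: similarity_class_def similar_mat_def)
  note wit = similar_mat_witD2[OF A(2,3)]
  note times = mat_coords_times[OF e, symmetric]
  have "x = vec_times (vec_times (mat_coords e P) (mat_coords e J)) (mat_coords e Q)"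
    using wit A(1) J by (simp add: times)
  moreover have "vec_times (mat_coords e P) (mat_coords e Q) = vec_one"
      "vec_times (mat_coords e Q) (mat_coords e P) = vec_one"
    using wit by (simp_all add: times mat_coords_one[OF e])
  ultimately show "x \<in> mat_alg.conj_class (mat_coords e J)" unfolding mat_alg.conj_class_def by blast
next
  fix x assume "x \<in> mat_alg.conj_class (mat_coords e J)"
  then obtain t u where tu: "vec_times t u = vec_one" "vec_times u t = vec_one"
      "x = vec_times (vec_times t (mat_coords e J)) u"
    unfolding mat_alg.conj_class_def by blast
  have surj: "\<exists>A\<in>carrier_mat n n. y = mat_coords e A" for y
    using mat_coords_bij[OF e] by (auto simp: bij_betw_def set_eq_iff image_iff)
  obtain P Q where PQ: "P \<in> carrier_mat n n" "t = mat_coords e P" "Q \<in> carrier_mat n n" "u = mat_coords e Q"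
    using surj[of t] surj[of u] by blast
  note times = mat_coords_times[OF e, symmetric]
  have inj: "A = B" if "mat_coords e A = mat_coords e B" "A \<in> carrier_mat n n" "B \<in> carrier_mat n n" for A B
    using mat_coords_bij[OF e] that by (auto simp: bij_betw_def inj_on_def)
  have "P * Q = 1\<^sub>m n" "Q * P = 1\<^sub>m n"
    by (rule inj, use tu PQ in \<open>simp_all add: times mat_coords_one[OF e]\<close>)+
  then have "similar_mat_wit (P * J * Q) J P Q"
    unfolding similar_mat_wit_def using PQ J by (auto simp: Let_def)
  then have "similar_mat (P * J * Q) J" unfolding similar_mat_def by blast
  moreover have "x = mat_coords e (P * J * Q)" using tu(3) PQ J by (simp add: times)
  ultimately show "x \<in> mat_coords e ` similarity_class n J"
    using PQ J by (auto simp: similarity_class_def)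
qed


theorem theorem6:
  fixes e :: "'n::finite \<Rightarrow> nat" and n p Nmax :: nat
    and J :: "complex mat" and blocks :: "(nat \<times> complex) list"
    and lam :: "nat \<Rightarrow> complex" and N m :: "nat \<Rightarrow> nat" and k :: "nat \<Rightarrow> nat \<Rightarrow> nat"
  assumes "bij_betw e UNIV {..<n}"
    and "J = jordan_matrix blocks" and "J \<in> carrier_mat n n"
    and "inj_on lam {1..p}"
    and "mset blocks = (\<Sum>a\<in>{1..p}. image_mset (\<lambda>j. (k a j, lam a)) (mset_set {1..N a}))"
    and "\<And>a. a \<in> {1..p} \<Longrightarrow> N a \<ge> 1"
    and "\<And>a i j. a \<in> {1..p} \<Longrightarrow> 1 \<le> i \<Longrightarrow> i \<le> j \<Longrightarrow> j \<le> N a \<Longrightarrow> k a i \<ge> k a j"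
    and "\<And>a. a \<in> {1..p} \<Longrightarrow> k a (N a) \<ge> 1"
    and "\<And>a j. a \<in> {1..p} \<Longrightarrow> j > N a \<Longrightarrow> k a j = 0"
    and "Nmax = Max (N ` {1..p})"
    and "\<And>j. m j = (\<Sum>a=1..p. k a j)"
  shows "(\<exists>d. complex_submanifold (mat_coords e ` similarity_class n J) d) \<and>
         int (complex_dim (mat_coords e ` similarity_class n J)) =
           (int n)\<^sup>2 - (\<Sum>j=1..Nmax. (2 * int j - 1) * (\<Sum>a=1..p. int (k a j))) \<and>
         int (complex_dim (mat_coords e ` similarity_class n J)) =
           (int n)\<^sup>2 - (\<Sum>j=1..Nmax. (2 * int j - 1) * int (m j)) \<and>
         (\<forall>j\<in>{1..n}. degree (invariant_poly J j) = m j)"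
proof -

  \<comment> \<open>Labelling the rows by eigenvalue, block and offset\<close>
  define L where "L = (SIGMA a:{1..p}. {1..N a})"
  define s where "s = (\<lambda>(a, j). k a j)"
  define l where "l = (\<lambda>(a :: nat, j :: nat). lam a)"
  have finL: "finite L" by (simp add: L_def)
  have eigenspace: "{b\<in>L. l b = lam a} = Pair a ` {1..N a}" if a: "a \<in> {1..p}" for a
  proof (intro equalityI subsetI)
    fix b assume "b \<in> {b\<in>L. l b = lam a}"
    then obtain a' j where b: "b = (a', j)" "a' \<in> {1..p}" "j \<in> {1..N a'}" "lam a' = lam a"
      by (auto simp: L_def l_def)
    then have "a' = a" using inj_onD[OF assms(4)] a by blast
    then show "b \<in> Pair a ` {1..N a}" using b by blast
  qed (use a in \<open>auto simp: L_def l_def\<close>)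
  obtain \<iota> where \<iota>: "bij_betw \<iota> {..<n} (SIGMA b:L. {..<s b})"
    and J_entry: "\<And>r c. r < n \<Longrightarrow> c < n \<Longrightarrow> J $$ (r, c) = jordan_entry l (\<iota> r) (\<iota> c)"
  proof -
    have n: "sum_list (map fst blocks) = n" using assms(2,3) by auto
    obtain g where g: "bij_betw g {..<n} (SIGMA b:{..<length blocks}. {..<fst (blocks ! b)})"
      and Jg: "\<And>r c. r < n \<Longrightarrow> c < n \<Longrightarrow> J $$ (r, c) = jordan_entry (\<lambda>b. snd (blocks ! b)) (g r) (g c)"
      using jordan_matrix_entries[of blocks] unfolding n assms(2) by blast
    \<comment> \<open>The hypothesis adds one multiset per eigenvalue; here they are merged into one
      image over the pairs in \<open>L\<close>.\<close>
    have "mset blocks = image_mset (\<lambda>b. (s b, l b)) (mset_set L)"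
    proof -
      have "mset_set L = (\<Sum>a\<in>{1..p}. image_mset (Pair a) (mset_set {1..N a}))"
      proof -
        have "mset_set (SIGMA a:A. {1..N a}) = (\<Sum>a\<in>A. image_mset (Pair a) (mset_set {1..N a}))"
          if "finite A" for A :: "nat set"
          using that
        proof (induction A rule: finite_induct)
          case (insert x A)
          have "(SIGMA a:insert x A. {1..N a}) = Pair x ` {1..N x} \<union> (SIGMA a:A. {1..N a})" by auto
          moreover have "mset_set (Pair x ` {1..N x} \<union> (SIGMA a:A. {1..N a}))
              = mset_set (Pair x ` {1..N x}) + mset_set (SIGMA a:A. {1..N a})"
            by (rule mset_set_Union) (use insert in auto)
          moreover have "mset_set (Pair x ` {1..N x}) = image_mset (Pair x) (mset_set {1..N x})"
            by (rule image_mset_mset_set[symmetric]) (simp add: inj_on_def)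
          ultimately show ?case using insert by simp
        qed simp
        then show ?thesis by (simp add: L_def)
      qed
      moreover have "image_mset f (\<Sum>a\<in>A. M a) = (\<Sum>a\<in>A. image_mset f (M a))" if "finite A"
        for A :: "nat set" and f :: "nat \<times> nat \<Rightarrow> nat \<times> complex" and M
        using that by (induction A rule: finite_induct) simp_all
      ultimately show ?thesis
        by (simp add: assms(5) multiset.map_comp o_def s_def l_def)
    qed
    then obtain h where h: "bij_betw h {..<length blocks} L"
      and blocks: "\<And>i. i < length blocks \<Longrightarrow> blocks ! i = (s (h i), l (h i))"
      using mset_eq_image_mset_setD[OF _ finL] by blast
    have "bij_betw (\<lambda>(b, i). (h b, i)) (SIGMA b:{..<length blocks}. {..<fst (blocks ! b)}) (SIGMA b:L. {..<s b})"
    proof (rule bij_betw_byWitness[where f' = "\<lambda>(b, i). (inv_into {..<length blocks} h b, i)"])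
      have inv: "inv_into {..<length blocks} h b < length blocks" "h (inv_into {..<length blocks} h b) = b"
        if "b \<in> L" for b
        using h that inv_into_into[of b h "{..<length blocks}"] f_inv_into_f[of b h "{..<length blocks}"]
        by (auto simp: bij_betw_def)
      have inv': "inv_into {..<length blocks} h (h b) = b" if "b < length blocks" for b
        using h that by (auto simp: bij_betw_def)
      show "\<forall>x\<in>SIGMA b:{..<length blocks}. {..<fst (blocks ! b)}.
          (case case x of (b, i) \<Rightarrow> (h b, i) of (b, i) \<Rightarrow> (inv_into {..<length blocks} h b, i)) = x"
        using inv' by auto
      show "\<forall>x\<in>SIGMA b:L. {..<s b}.
          (case case x of (b, i) \<Rightarrow> (inv_into {..<length blocks} h b, i) of (b, i) \<Rightarrow> (h b, i)) = x"
        using inv by auto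
      show "(\<lambda>(b, i). (h b, i)) ` (SIGMA b:{..<length blocks}. {..<fst (blocks ! b)}) \<subseteq> (SIGMA b:L. {..<s b})"
        using h blocks by (auto simp: bij_betw_def)
      show "(\<lambda>(b, i). (inv_into {..<length blocks} h b, i)) ` (SIGMA b:L. {..<s b})
          \<subseteq> (SIGMA b:{..<length blocks}. {..<fst (blocks ! b)})"
        using inv blocks by auto
    qed
    from bij_betw_trans[OF g this]
    have bij: "bij_betw (\<lambda>r. (h (fst (g r)), snd (g r))) {..<n} (SIGMA b:L. {..<s b})"
      by (simp add: o_def case_prod_unfold)
    have "J $$ (r, c) = jordan_entry l (h (fst (g r)), snd (g r)) (h (fst (g c)), snd (g c))"
      if "r < n" "c < n" for r c
    proof -
      have "g x \<in> (SIGMA b:{..<length blocks}. {..<fst (blocks ! b)})" if "x < n" for x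
        using bij_betwE[OF g] that by blast
      from this[OF that(1)] this[OF that(2)]
      have "fst (g r) < length blocks" "fst (g c) < length blocks" by auto
      then show ?thesis
        using Jg[OF that] blocks h by (auto simp: jordan_entry_def bij_betw_def inj_on_def)
    qed
    then show ?thesis using that[OF bij] by blast
  qed
  interpret jordan_labels n L s l \<iota> J
  proof
    show "s b \<ge> 1" if b: "b \<in> L" for b
    proof -
      obtain a j where "b = (a, j)" "a \<in> {1..p}" "j \<in> {1..N a}" using b by (auto simp: L_def)
      then show ?thesis using assms(7)[of a j "N a"] assms(8)[of a] by (auto simp: s_def)
    qed
  qed (use finL \<iota> assms(3) J_entry in auto)

  \<comment> \<open>The similarity class as a submanifold\<close>
  let ?x = "mat_coords e J"
  let ?S = "mat_coords e ` similarity_class n J"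
  define d where "d = vec.dim (range (mat_alg.ad ?x))"
  have S: "?S = mat_alg.conj_class ?x" by (rule mat_coords_similarity_class[OF assms(1,3)])
  have sub: "complex_submanifold ?S d"
    unfolding S d_def by (rule mat_alg.complex_submanifold_conj_class)
  moreover have "?S \<noteq> {}" unfolding S using mat_alg.conj_class_refl by blast
  ultimately have dim: "complex_dim ?S = d" by (rule complex_dim_eq[rotated])

  \<comment> \<open>Dimension of the commutant and of the class\<close>
  have cardn: "CARD('n) = n" using bij_betw_same_card[OF assms(1)] by simp
  have bij_\<iota>e: "bij_betw (\<iota> \<circ> e) UNIV (SIGMA b:L. {..<s b})"
    by (rule bij_betw_trans[OF assms(1) \<iota>])
  have "e i < n" for i using assms(1) by (auto simp: bij_betw_def)
  then have x_entry: "?x $ (r, c) = jordan_entry l ((\<iota> \<circ> e) r) ((\<iota> \<circ> e) c)" for r c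
    by (simp add: mat_coords_def J_entry)
  have "{X. mat_alg.ad ?x X = 0} = {X :: complex ^ ('n \<times> 'n). \<forall>r c.
        (\<Sum>i\<in>UNIV. X $ (r, i) * jordan_entry l ((\<iota> \<circ> e) i) ((\<iota> \<circ> e) c))
          = (\<Sum>i\<in>UNIV. jordan_entry l ((\<iota> \<circ> e) r) ((\<iota> \<circ> e) i) * X $ (i, c))}"
    unfolding mat_alg.ad_def x_entry[symmetric]
    by (simp add: vec_times_def Finite_Cartesian_Product.vec_eq_iff)
  then have "vec.dim {X. mat_alg.ad ?x X = 0} = (\<Sum>d\<in>L. \<Sum>b\<in>{b\<in>L. l b = l d}. min (s d) (s b))"
    using dim_jordan_commutant[OF bij_\<iota>e finL] by simp
  also have "\<dots> = (\<Sum>a=1..p. \<Sum>i=1..N a. \<Sum>j=1..N a. min (k a i) (k a j))"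
  proof -
    have "(\<Sum>b\<in>{b\<in>L. l b = l (a, i)}. min (s (a, i)) (s b)) = (\<Sum>j=1..N a. min (k a i) (k a j))"
      if "(a, i) \<in> L" for a i
    proof -
      have "{b\<in>L. l b = l (a, i)} = Pair a ` {1..N a}"
        using that eigenspace[of a] by (simp add: L_def l_def)
      then show ?thesis by (simp add: sum.reindex inj_on_def s_def)
    qed
    then have "(\<Sum>d\<in>L. \<Sum>b\<in>{b\<in>L. l b = l d}. min (s d) (s b))
        = (\<Sum>(a, i)\<in>L. \<Sum>j=1..N a. min (k a i) (k a j))"
      by (intro sum.cong refl) auto
    also have "\<dots> = (\<Sum>a=1..p. \<Sum>i=1..N a. \<Sum>j=1..N a. min (k a i) (k a j))"
      unfolding L_def by (rule sum.Sigma[symmetric]) auto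
    finally show ?thesis .
  qed
  also have "\<dots> = (\<Sum>a=1..p. \<Sum>j=1..N a. (2 * j - 1) * k a j)"
    by (intro sum.cong refl sum_min_antimono) (use assms(7) in auto)
  also have "\<dots> = (\<Sum>a=1..p. \<Sum>j=1..Nmax. (2 * j - 1) * k a j)"
  proof (rule sum.cong[OF refl])
    fix a assume a: "a \<in> {1..p}"
    then have "N a \<le> Nmax" unfolding assms(10) by (intro Max_ge) auto
    moreover have "k a j = 0" if "j \<in> {1..Nmax} - {1..N a}" for j
      using assms(9)[OF a, of j] that by auto
    ultimately show "(\<Sum>j=1..N a. (2 * j - 1) * k a j) = (\<Sum>j=1..Nmax. (2 * j - 1) * k a j)"
      by (intro sum.mono_neutral_left) auto
  qed
  also have "\<dots> = (\<Sum>j=1..Nmax. (2 * j - 1) * m j)"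
    unfolding assms(11) sum_distrib_left by (rule sum.swap)
  finally have ker: "vec.dim {X. mat_alg.ad ?x X = 0} = (\<Sum>j=1..Nmax. (2 * j - 1) * m j)" .
  have "d + (\<Sum>j=1..Nmax. (2 * j - 1) * m j) = n\<^sup>2"
    using vec_dim_range_plus_kernel[OF mat_alg.linear_ad[of ?x]] unfolding ker d_def
    by (simp add: cardn power2_eq_square)
  then have "int d + int (\<Sum>j=1..Nmax. (2 * j - 1) * m j) = (int n)\<^sup>2"
    by (metis of_nat_add of_nat_power)
  \<comment> \<open>The truncated difference \<open>2 * j - 1\<close> is exact because the sum
    starts at 1.\<close>
  moreover have "int (\<Sum>j=1..Nmax. (2 * j - 1) * m j) = (\<Sum>j=1..Nmax. (2 * int j - 1) * int (m j))"
    unfolding of_nat_sum by (intro sum.cong refl) (auto simp: of_nat_diff)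
  ultimately have dim_m: "int d = (int n)\<^sup>2 - (\<Sum>j=1..Nmax. (2 * int j - 1) * int (m j))" by simp
  have m_int: "(\<Sum>a=1..p. int (k a j)) = int (m j)" for j by (simp add: assms(11))

  \<comment> \<open>Degrees of the invariant polynomials\<close>
  define ex where "ex j a = sum (k a) {j<..N a}" for j a
  \<comment> \<open>\<open>ex j a\<close> is the total order of all but the \<open>j\<close> largest
    blocks for \<open>lam a\<close>. So \<open>E j\<close> is the candidate for the determinantal
    divisor of order \<open>n - j\<close>; agreement up to a unit suffices for degrees.\<close>
  define E where "E j = (\<Prod>a=1..p. [:- lam a, 1:] ^ ex j a)" for j
  have E_degree: "degree (E j) = (\<Sum>a=1..p. ex j a)" for j
    unfolding E_def by (subst degree_prod_eq_sum_degree) (simp_all add: degree_power_eq)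
  have E_nz: "E j \<noteq> 0" for j by (simp add: E_def)
  have D: "\<exists>u. det_divisor J (n - j) = E j * u \<and> u dvd 1 \<and>
      degree (det_divisor J (n - j)) = (\<Sum>a=1..p. ex j a) \<and> det_divisor J (n - j) \<noteq> 0"
    if j: "j \<le> n" for j
  proof (rule det_divisor_eq[OF j, of "E j"])
    fix U assume U: "U \<subseteq> L" "card U \<le> j"
    have "(\<Prod>b\<in>L - U. [:- l b, 1:] ^ s b)
        = (\<Prod>(a, i)\<in>(SIGMA a:{1..p}. {1..N a} - {i. (a, i) \<in> U}). [:- lam a, 1:] ^ k a i)"
      by (rule prod.cong) (auto simp: L_def l_def s_def)
    also have "\<dots> = (\<Prod>a=1..p. \<Prod>i\<in>{1..N a} - {i. (a, i) \<in> U}. [:- lam a, 1:] ^ k a i)"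
      by (rule prod.Sigma[symmetric]) auto
    also have "\<dots> = (\<Prod>a=1..p. [:- lam a, 1:] ^ sum (k a) ({1..N a} - {i. (a, i) \<in> U}))"
      by (simp add: power_sum)
    finally have eq: "(\<Prod>b\<in>L - U. [:- l b, 1:] ^ s b)
        = (\<Prod>a=1..p. [:- lam a, 1:] ^ sum (k a) ({1..N a} - {i. (a, i) \<in> U}))" .
    show "E j dvd (\<Prod>b\<in>L - U. [:- l b, 1:] ^ s b)"
      unfolding eq E_def
    proof (intro prod_dvd_prod le_imp_power_dvd)
      fix a assume a: "a \<in> {1..p}"
      \<comment> \<open>The part of \<open>U\<close> belonging to one eigenvalue also has at most
        \<open>j\<close> blocks, so at least the tail sum survives for each eigenvalue
        separately.\<close>
      define V where "V = {i. (a, i) \<in> U}"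
      have "card V = card (Pair a ` V)" by (rule card_image[symmetric]) (simp add: inj_on_def)
      also have "\<dots> \<le> card U" by (rule card_mono) (use U finL finite_subset in \<open>auto simp: V_def\<close>)
      finally have "card V \<le> j" using U by simp
      moreover have "V \<subseteq> {1..N a}" using U by (auto simp: V_def L_def)
      ultimately show "ex j a \<le> sum (k a) ({1..N a} - {i. (a, i) \<in> U})"
        unfolding ex_def V_def[symmetric] by (intro sum_tail_le_sum_Diff assms(7)[OF a])
    qed
  next
    fix c
    show "\<exists>T\<subseteq>L. card T \<le> j \<and> (\<Sum>b\<in>{b\<in>L. l b = c} - T. s b) \<le> Polynomial.order c (E j)"
    proof (cases "c \<in> lam ` {1..p}")
      case True
      then obtain a where a: "a \<in> {1..p}" "c = lam a" by blast
      \<comment> \<open>The \<open>j\<close> largest blocks for this eigenvalue, or all of them if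
        there are fewer; the remaining orders add up to \<open>ex j a\<close>.\<close>
      define T where "T = Pair a ` {1..min j (N a)}"
      have "card T \<le> card {1..min j (N a)}" unfolding T_def by (rule card_image_le) simp
      then have "card T \<le> j" by simp
      moreover have "T \<subseteq> L" using a by (auto simp: T_def L_def)
      moreover have "{b\<in>L. l b = c} - T = Pair a ` {j<..N a}"
        unfolding a(2) eigenspace[OF a(1)] by (auto simp: T_def image_iff)
      then have "(\<Sum>b\<in>{b\<in>L. l b = c} - T. s b) = ex j a"
        by (simp add: sum.reindex inj_on_def s_def ex_def)
      moreover have "[:- c, 1:] ^ ex j a dvd E j"
        unfolding E_def a(2) by (rule dvd_prodI[of "{1..p}" a]) (use a in auto)
      then have "ex j a \<le> Polynomial.order c (E j)" using E_nz by (simp add: order_divides)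
      ultimately show ?thesis by (intro exI[of _ T]) simp
    next
      case False
      then have "{b\<in>L. l b = c} = {}" by (auto simp: L_def l_def)
      then have "(\<Sum>b\<in>{b\<in>L. l b = c} - {}. s b) = 0" by (simp only: empty_Diff sum.empty)
      then show ?thesis by (intro exI[of _ "{}"]) simp
    qed
  next
    fix u assume "det_divisor J (n - j) = E j * u" "u dvd 1"
      "degree (det_divisor J (n - j)) = degree (E j)" "det_divisor J (n - j) \<noteq> 0"
    then show ?thesis using E_degree by auto
  qed
  have "degree (invariant_poly J j) = m j" if j: "j \<in> {1..n}" for j
  proof -
    have nj: "n - j + 1 = n - (j - 1)" using j by auto
    define D1 where "D1 = det_divisor J (n - (j - 1))"
    define D2 where "D2 = det_divisor J (n - j)"
    have "j \<le> n" "j - 1 \<le> n" using j by auto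
    note D12 = D[OF this(1), folded D2_def] D[OF this(2), folded D1_def]
    obtain u where u: "D2 = E j * u" "u dvd 1" "D2 \<noteq> 0" and deg2: "degree D2 = (\<Sum>a=1..p. ex j a)"
      using D12(1) by blast
    obtain v where v: "D1 = E (j - 1) * v" "D1 \<noteq> 0" and deg1: "degree D1 = (\<Sum>a=1..p. ex (j - 1) a)"
      using D12(2) by blast
    \<comment> \<open>Consecutive exponents differ by the order of the \<open>j\<close>-th block,
      which is 0 once the blocks for \<open>lam a\<close> are exhausted.\<close>
    have ex: "ex (j - 1) a = k a j + ex j a" if a: "a \<in> {1..p}" for a
    proof (cases "j \<le> N a")
      case True
      then have "{j - 1<..N a} = insert j {j<..N a}" using j by auto
      then show ?thesis by (simp add: ex_def)
    next
      case False
      then show ?thesis using assms(9)[OF a, of j] by (simp add: ex_def)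
    qed
    \<comment> \<open>Divisibility makes the quotient in \<open>invariant_poly\<close> exact, so
      that its degree is the difference of the two degrees.\<close>
    have "E j dvd E (j - 1)"
      unfolding E_def by (intro prod_dvd_prod le_imp_power_dvd) (use ex in simp)
    then have "D2 dvd D1" unfolding u(1) v(1) using u(2) by (simp add: mult_unit_dvd_iff)
    then obtain w where w: "D1 = D2 * w" by (rule dvdE)
    then have "w \<noteq> 0" using v by auto
    then have "degree D1 = degree D2 + degree w" unfolding w using u(3) by (intro degree_mult_eq)
    moreover have "(\<Sum>a=1..p. ex (j - 1) a) = m j + (\<Sum>a=1..p. ex j a)"
      unfolding assms(11) sum.distrib[symmetric] by (rule sum.cong[OF refl ex])
    ultimately have "degree w = m j" using deg1 deg2 by simp
    moreover have "invariant_poly J j = D1 div D2"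
      using assms(3) nj by (simp add: invariant_poly_def D1_def D2_def)
    then have "invariant_poly J j = w" using w u(3) by simp
    ultimately show ?thesis by simp
  qed
  then show ?thesis using sub dim dim_m m_int by auto
qed

end
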